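(* Let $\mathcal C$ be a category. Any $\mathrm{O}(1)$-volutive structure $(d,\eta)$ on $\mathcal C$ induces an $\mathrm{O}(1)$-volutive structure $(d',\eta')$ on the idempotent completion $I\mathcal C$. Moreover, the assignment $(\mathcal C,d,\eta)\mapsto(I\mathcal C,d',\eta')$ extends to a 2-functor $$I_{\mathrm{O}(1)}\colon \mathrm{Cat}^{\mathrm{O}(1)\text{-vol}}\longrightarrow\mathrm{Cat}^{\mathrm{O}(1)\text{-vol}} .$$
   Context: The idempotent completion $I\mathcal C$ of a category $\mathcal C$ has objects the pairs $(a,e)$ with $a\in\mathcal C$ and $e\colon a\to a$, $e\circ e=e$; morphisms $(a,e)\to(b,f)$ are morphisms $X\colon a\to b$ in $\mathcal C$ with $f\circ X=X=X\circ e$; the identity of $(a,e)$ is $e$, and composition is that of $\mathcal C$. An $\mathrm{O}(1)$-volutive structure on a category $\mathcal C$ is a pair $(d,\eta)$ of a functor $d\colon\mathcal C\to\mathcal C^{\mathrm{op}}$ and a natural isomorphism $\eta\colon d^{\mathrm{op}}\circ d\Rightarrow\mathrm{id}_{\mathcal C}$ with $d(\eta_a)=\eta_{d(a)}^{-1}$ for all $a\in\mathcal C$. The 2-category $\mathrm{Cat}^{\mathrm{O}(1)\text{-vol}}$: - Objects are $\mathrm{O}(1)$-volutive categories $(\mathcal C,d,\eta)$, i.e. categories $\mathcal C$ with an $\mathrm{O}(1)$-volutive structure $(d,\eta)$. - 1-morphisms $(\mathcal C,d,\eta)\to(\mathcal C',d',\eta')$ are pairs $(F,\alpha)$ of a functor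 $F\colon\mathcal C\to\mathcal C'$ and a natural isomorphism $\alpha\colon F^{\mathrm{op}}\circ d\Rightarrow d'\circ F$ such that $(\mathrm{id}_F\circ\eta)\bullet(\alpha^{\mathrm{op}}\circ\mathrm{id}_d)=(\eta'\circ\mathrm{id}_F)\bullet(\mathrm{id}_{(d')^{\mathrm{op}}}\circ\alpha)$ as transformations $(d')^{\mathrm{op}}\circ F^{\mathrm{op}}\circ d\Rightarrow F$ (here $\circ$ denotes horizontal and $\bullet$ vertical composition). - 2-morphisms $(F_1,\alpha_1)\to(F_2,\alpha_2)$ are natural transformations $\varphi\colon F_1\Rightarrow F_2$ such that $(\mathrm{id}_{d'}\circ\varphi)\bullet\alpha_1\bullet(\varphi^{\mathrm{op}}\circ\mathrm{id}_d)=\alpha_2$. *)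

theory Defs
  imports "HOL-Library.FuncSet"
begin

section \<open>Categories\<close>

text \<open>
  A category is given by a set of objects and a family of hom-sets, which need not be disjoint;
  \<open>Comp C a b c g f\<close> is the composite of \<open>f\<close> in \<open>Hom C a b\<close> and \<open>g\<close> in \<open>Hom C b c\<close>.
  All structure (here and for functors and transformations) is required to be \<open>undefined\<close> outside
  its domain, so that HOL equality is equality of categories, functors and transformations.
\<close>

record ('o, 'm) precategory =
  Obj :: "'o set"
  Hom :: "'o \<Rightarrow> 'o \<Rightarrow> 'm set"
  Idt :: "'o \<Rightarrow> 'm"
  Comp :: "'o \<Rightarrow> 'o \<Rightarrow> 'o \<Rightarrow> 'm \<Rightarrow> 'm \<Rightarrow> 'm"

locale category =
  fixes C :: "('o, 'm) precategory"
  assumes Hom_Obj: "f \<in> Hom C a b \<Longrightarrow> a \<in> Obj C \<and> b \<in> Obj C"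
    and Idt_Hom: "a \<in> Obj C \<Longrightarrow> Idt C a \<in> Hom C a a"
    and Comp_Hom: "g \<in> Hom C b c \<Longrightarrow> f \<in> Hom C a b \<Longrightarrow> Comp C a b c g f \<in> Hom C a c"
    and Comp_Idt: "f \<in> Hom C a b \<Longrightarrow> Comp C a a b f (Idt C a) = f"
    and Idt_Comp: "f \<in> Hom C a b \<Longrightarrow> Comp C a b b (Idt C b) f = f"
    and Comp_assoc: "h \<in> Hom C c d \<Longrightarrow> g \<in> Hom C b c \<Longrightarrow> f \<in> Hom C a b \<Longrightarrow>
      Comp C a b d (Comp C b c d h g) f = Comp C a c d h (Comp C a b c g f)"
    and Idt_ext: "a \<notin> Obj C \<Longrightarrow> Idt C a = undefined"
    and Comp_ext: "\<not> (g \<in> Hom C b c \<and> f \<in> Hom C a b) \<Longrightarrow> Comp C a b c g f = undefined"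

definition inverse_pair :: "('o, 'm) precategory \<Rightarrow> 'o \<Rightarrow> 'o \<Rightarrow> 'm \<Rightarrow> 'm \<Rightarrow> bool" where
  "inverse_pair C a b f g \<longleftrightarrow> f \<in> Hom C a b \<and> g \<in> Hom C b a \<and>
     Comp C a b a g f = Idt C a \<and> Comp C b a b f g = Idt C b"

definition iso_mor :: "('o, 'm) precategory \<Rightarrow> 'o \<Rightarrow> 'o \<Rightarrow> 'm \<Rightarrow> bool" where
  "iso_mor C a b f \<longleftrightarrow> (\<exists>g. inverse_pair C a b f g)"

definition inv_mor :: "('o, 'm) precategory \<Rightarrow> 'o \<Rightarrow> 'o \<Rightarrow> 'm \<Rightarrow> 'm" where
  "inv_mor C a b f = (THE g. inverse_pair C a b f g)"

definition op_cat :: "('o, 'm) precategory \<Rightarrow> ('o, 'm) precategory" where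
  "op_cat C = \<lparr>Obj = Obj C, Hom = (\<lambda>a b. Hom C b a), Idt = Idt C,
     Comp = (\<lambda>a b c g f. Comp C c b a f g)\<rparr>"

definition prod_cat ::
  "('o, 'm) precategory \<Rightarrow> ('p, 'n) precategory \<Rightarrow> ('o \<times> 'p, 'm \<times> 'n) precategory" where
  "prod_cat C D = (let H = (\<lambda>x y. Hom C (fst x) (fst y) \<times> Hom D (snd x) (snd y)) in
     \<lparr>Obj = Obj C \<times> Obj D,
      Hom = H,
      Idt = (\<lambda>x \<in> Obj C \<times> Obj D. (Idt C (fst x), Idt D (snd x))),
      Comp = (\<lambda>x y z. \<lambda>g f. if g \<in> H y z \<and> f \<in> H x y
        then (Comp C (fst x) (fst y) (fst z) (fst g) (fst f),
              Comp D (snd x) (snd y) (snd z) (snd g) (snd f))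
        else undefined)\<rparr>)"


section \<open>Functors and natural transformations\<close>

record ('o, 'm, 'p, 'n) prefunctor =
  Dom :: "('o, 'm) precategory"
  Cod :: "('p, 'n) precategory"
  FOb :: "'o \<Rightarrow> 'p"
  FMor :: "'o \<Rightarrow> 'o \<Rightarrow> 'm \<Rightarrow> 'n"

definition is_functor :: "('o, 'm, 'p, 'n) prefunctor \<Rightarrow> bool" where
  "is_functor F \<longleftrightarrow> category (Dom F) \<and> category (Cod F) \<and>
     FOb F \<in> Obj (Dom F) \<rightarrow>\<^sub>E Obj (Cod F) \<and>
     (\<forall>a b. FMor F a b \<in> Hom (Dom F) a b \<rightarrow>\<^sub>E Hom (Cod F) (FOb F a) (FOb F b)) \<and>
     (\<forall>a \<in> Obj (Dom F). FMor F a a (Idt (Dom F) a) = Idt (Cod F) (FOb F a)) \<and>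
     (\<forall>a b c. \<forall>g \<in> Hom (Dom F) b c. \<forall>f \<in> Hom (Dom F) a b.
        FMor F a c (Comp (Dom F) a b c g f) =
        Comp (Cod F) (FOb F a) (FOb F b) (FOb F c) (FMor F b c g) (FMor F a b f))"

definition functor_between ::
  "('o, 'm) precategory \<Rightarrow> ('p, 'n) precategory \<Rightarrow> ('o, 'm, 'p, 'n) prefunctor \<Rightarrow> bool" where
  "functor_between C D F \<longleftrightarrow> is_functor F \<and> Dom F = C \<and> Cod F = D"

definition id_functor :: "('o, 'm) precategory \<Rightarrow> ('o, 'm, 'o, 'm) prefunctor" where
  "id_functor C = \<lparr>Dom = C, Cod = C, FOb = (\<lambda>a \<in> Obj C. a), FMor = (\<lambda>a b. \<lambda>f \<in> Hom C a b. f)\<rparr>"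

definition comp_functor ::
  "('p, 'n, 'q, 'k) prefunctor \<Rightarrow> ('o, 'm, 'p, 'n) prefunctor \<Rightarrow> ('o, 'm, 'q, 'k) prefunctor"
  (infixl "\<circ>\<^sub>F" 70) where
  "G \<circ>\<^sub>F F = \<lparr>Dom = Dom F, Cod = Cod G,
     FOb = (\<lambda>a \<in> Obj (Dom F). FOb G (FOb F a)),
     FMor = (\<lambda>a b. \<lambda>f \<in> Hom (Dom F) a b. FMor G (FOb F a) (FOb F b) (FMor F a b f))\<rparr>"

definition op_functor :: "('o, 'm, 'p, 'n) prefunctor \<Rightarrow> ('o, 'm, 'p, 'n) prefunctor" where
  "op_functor F = \<lparr>Dom = op_cat (Dom F), Cod = op_cat (Cod F),
     FOb = FOb F, FMor = (\<lambda>a b. FMor F b a)\<rparr>"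

record ('o, 'm, 'p, 'n) pretransformation =
  Src :: "('o, 'm, 'p, 'n) prefunctor"
  Trg :: "('o, 'm, 'p, 'n) prefunctor"
  component :: "'o \<Rightarrow> 'n"

definition nat_trans ::
  "('o, 'm, 'p, 'n) prefunctor \<Rightarrow> ('o, 'm, 'p, 'n) prefunctor \<Rightarrow>
   ('o, 'm, 'p, 'n) pretransformation \<Rightarrow> bool" where
  "nat_trans F G \<tau> \<longleftrightarrow> is_functor F \<and> is_functor G \<and> Dom F = Dom G \<and> Cod F = Cod G \<and>
     Src \<tau> = F \<and> Trg \<tau> = G \<and>
     component \<tau> \<in> (\<Pi>\<^sub>E a \<in> Obj (Dom F). Hom (Cod F) (FOb F a) (FOb G a)) \<and>
     (\<forall>a b. \<forall>f \<in> Hom (Dom F) a b.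
        Comp (Cod F) (FOb F a) (FOb F b) (FOb G b) (component \<tau> b) (FMor F a b f) =
        Comp (Cod F) (FOb F a) (FOb G a) (FOb G b) (FMor G a b f) (component \<tau> a))"

definition nat_iso ::
  "('o, 'm, 'p, 'n) prefunctor \<Rightarrow> ('o, 'm, 'p, 'n) prefunctor \<Rightarrow>
   ('o, 'm, 'p, 'n) pretransformation \<Rightarrow> bool" where
  "nat_iso F G \<tau> \<longleftrightarrow> nat_trans F G \<tau> \<and>
     (\<forall>a \<in> Obj (Dom F). iso_mor (Cod F) (FOb F a) (FOb G a) (component \<tau> a))"

definition id_nt :: "('o, 'm, 'p, 'n) prefunctor \<Rightarrow> ('o, 'm, 'p, 'n) pretransformation" where
  "id_nt F = \<lparr>Src = F, Trg = F, component = (\<lambda>a \<in> Obj (Dom F). Idt (Cod F) (FOb F a))\<rparr>"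

definition vcomp ::
  "('o, 'm, 'p, 'n) pretransformation \<Rightarrow> ('o, 'm, 'p, 'n) pretransformation \<Rightarrow>
   ('o, 'm, 'p, 'n) pretransformation"
  (infixl "\<bullet>\<^sub>V" 65) where
  "\<sigma> \<bullet>\<^sub>V \<tau> = \<lparr>Src = Src \<tau>, Trg = Trg \<sigma>,
     component = (\<lambda>a \<in> Obj (Dom (Src \<tau>)).
       Comp (Cod (Src \<tau>)) (FOb (Src \<tau>) a) (FOb (Trg \<tau>) a) (FOb (Trg \<sigma>) a)
         (component \<sigma> a) (component \<tau> a))\<rparr>"

definition hcomp ::
  "('p, 'n, 'q, 'k) pretransformation \<Rightarrow> ('o, 'm, 'p, 'n) pretransformation \<Rightarrow>
   ('o, 'm, 'q, 'k) pretransformation"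
  (infixl "\<circ>\<^sub>H" 70) where
  "\<sigma> \<circ>\<^sub>H \<tau> = \<lparr>Src = Src \<sigma> \<circ>\<^sub>F Src \<tau>, Trg = Trg \<sigma> \<circ>\<^sub>F Trg \<tau>,
     component = (\<lambda>a \<in> Obj (Dom (Src \<tau>)). let b = FOb (Src \<tau>) a; c = FOb (Trg \<tau>) a in
       Comp (Cod (Src \<sigma>)) (FOb (Src \<sigma>) b) (FOb (Src \<sigma>) c) (FOb (Trg \<sigma>) c)
         (component \<sigma> c) (FMor (Src \<sigma>) b c (component \<tau> a)))\<rparr>"

text \<open>Taking opposites reverses transformations: from \<open>F \<Rightarrow> G\<close> one gets \<open>G\<^sup>o\<^sup>p \<Rightarrow> F\<^sup>o\<^sup>p\<close>.\<close>

definition op_nt :: "('o, 'm, 'p, 'n) pretransformation \<Rightarrow> ('o, 'm, 'p, 'n) pretransformation" where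
  "op_nt \<tau> = \<lparr>Src = op_functor (Trg \<tau>), Trg = op_functor (Src \<tau>), component = component \<tau>\<rparr>"


section \<open>Strict 2-categories and strict 2-functors\<close>

text \<open>A 2-category is a category enriched in categories.\<close>

record ('v, 'f, 't) pre2category =
  Obj2 :: "'v set"
  HomCat :: "'v \<Rightarrow> 'v \<Rightarrow> ('f, 't) precategory"
  Unit1 :: "'v \<Rightarrow> 'f"
  HComp :: "'v \<Rightarrow> 'v \<Rightarrow> 'v \<Rightarrow> ('f \<times> 'f, 't \<times> 't, 'f, 't) prefunctor"

locale strict_2category =
  fixes K :: "('v, 'f, 't) pre2category"
  assumes HomCat_category: "\<lbrakk>A \<in> Obj2 K; B \<in> Obj2 K\<rbrakk> \<Longrightarrow> category (HomCat K A B)"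
    and Unit1_Obj: "A \<in> Obj2 K \<Longrightarrow> Unit1 K A \<in> Obj (HomCat K A A)"
    and HComp_functor: "\<lbrakk>A \<in> Obj2 K; B \<in> Obj2 K; C \<in> Obj2 K\<rbrakk> \<Longrightarrow>
      functor_between (prod_cat (HomCat K B C) (HomCat K A B)) (HomCat K A C) (HComp K A B C)"
    and assoc_1cells:
      "\<lbrakk>A \<in> Obj2 K; B \<in> Obj2 K; C \<in> Obj2 K; D \<in> Obj2 K;
        f \<in> Obj (HomCat K A B); g \<in> Obj (HomCat K B C); h \<in> Obj (HomCat K C D)\<rbrakk> \<Longrightarrow>
       FOb (HComp K A B D) (FOb (HComp K B C D) (h, g), f) =
       FOb (HComp K A C D) (h, FOb (HComp K A B C) (g, f))"
    and assoc_2cells: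
      "\<lbrakk>A \<in> Obj2 K; B \<in> Obj2 K; C \<in> Obj2 K; D \<in> Obj2 K;
        x \<in> Hom (HomCat K A B) f f'; y \<in> Hom (HomCat K B C) g g';
        z \<in> Hom (HomCat K C D) h h'\<rbrakk> \<Longrightarrow>
       FMor (HComp K A B D) (FOb (HComp K B C D) (h, g), f) (FOb (HComp K B C D) (h', g'), f')
         (FMor (HComp K B C D) (h, g) (h', g') (z, y), x) =
       FMor (HComp K A C D) (h, FOb (HComp K A B C) (g, f)) (h', FOb (HComp K A B C) (g', f'))
         (z, FMor (HComp K A B C) (g, f) (g', f') (y, x))"
    and unit_1cells:
      "\<lbrakk>A \<in> Obj2 K; B \<in> Obj2 K; f \<in> Obj (HomCat K A B)\<rbrakk> \<Longrightarrow>
       FOb (HComp K A A B) (f, Unit1 K A) = f \<and> FOb (HComp K A B B) (Unit1 K B, f) = f"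
    and unit_2cells:
      "\<lbrakk>A \<in> Obj2 K; B \<in> Obj2 K; x \<in> Hom (HomCat K A B) f f'\<rbrakk> \<Longrightarrow>
       FMor (HComp K A A B) (f, Unit1 K A) (f', Unit1 K A)
         (x, Idt (HomCat K A A) (Unit1 K A)) = x \<and>
       FMor (HComp K A B B) (Unit1 K B, f) (Unit1 K B, f')
         (Idt (HomCat K B B) (Unit1 K B), x) = x"

record ('v, 'f, 't, 'w, 'g, 's) pre2functor =
  FOb2 :: "'v \<Rightarrow> 'w"
  FHom :: "'v \<Rightarrow> 'v \<Rightarrow> ('f, 't, 'g, 's) prefunctor"

locale strict_2functor = S: strict_2category K + T: strict_2category L
  for K :: "('v, 'f, 't) pre2category" and L :: "('w, 'g, 's) pre2category" +
  fixes P :: "('v, 'f, 't, 'w, 'g, 's) pre2functor"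
  assumes FOb2_Obj: "A \<in> Obj2 K \<Longrightarrow> FOb2 P A \<in> Obj2 L"
    and FHom_functor: "\<lbrakk>A \<in> Obj2 K; B \<in> Obj2 K\<rbrakk> \<Longrightarrow>
      functor_between (HomCat K A B) (HomCat L (FOb2 P A) (FOb2 P B)) (FHom P A B)"
    and pres_Unit1: "A \<in> Obj2 K \<Longrightarrow> FOb (FHom P A A) (Unit1 K A) = Unit1 L (FOb2 P A)"
    and pres_HComp_1cells:
      "\<lbrakk>A \<in> Obj2 K; B \<in> Obj2 K; C \<in> Obj2 K;
        f \<in> Obj (HomCat K A B); g \<in> Obj (HomCat K B C)\<rbrakk> \<Longrightarrow>
       FOb (FHom P A C) (FOb (HComp K A B C) (g, f)) =
       FOb (HComp L (FOb2 P A) (FOb2 P B) (FOb2 P C)) (FOb (FHom P B C) g, FOb (FHom P A B) f)"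
    and pres_HComp_2cells:
      "\<lbrakk>A \<in> Obj2 K; B \<in> Obj2 K; C \<in> Obj2 K;
        x \<in> Hom (HomCat K A B) f f'; y \<in> Hom (HomCat K B C) g g'\<rbrakk> \<Longrightarrow>
       FMor (FHom P A C) (FOb (HComp K A B C) (g, f)) (FOb (HComp K A B C) (g', f'))
         (FMor (HComp K A B C) (g, f) (g', f') (y, x)) =
       FMor (HComp L (FOb2 P A) (FOb2 P B) (FOb2 P C))
         (FOb (FHom P B C) g, FOb (FHom P A B) f) (FOb (FHom P B C) g', FOb (FHom P A B) f')
         (FMor (FHom P B C) g g' y, FMor (FHom P A B) f f' x)"


section \<open>The 2-category of O(1)-volutive categories\<close>

text \<open>
  As \<open>d\<close> is a functor from \<open>C\<close> to the opposite of \<open>C\<close>, the value of \<open>d\<close> on the component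
  \<open>d d a \<rightarrow> a\<close> of \<open>\<eta>\<close> is a morphism \<open>d a \<rightarrow> d d d a\<close> of \<open>C\<close>.
\<close>

definition volutive_structure ::
  "('o, 'm) precategory \<Rightarrow> ('o, 'm, 'o, 'm) prefunctor \<Rightarrow> ('o, 'm, 'o, 'm) pretransformation
    \<Rightarrow> bool" where
  "volutive_structure C d \<eta> \<longleftrightarrow> category C \<and> functor_between C (op_cat C) d \<and>
     nat_iso (op_functor d \<circ>\<^sub>F d) (id_functor C) \<eta> \<and>
     (\<forall>a \<in> Obj C. let da = FOb d a; dda = FOb d da; ddda = FOb d dda in
        FMor d dda a (component \<eta> a) = inv_mor C ddda da (component \<eta> da))"

record ('o, 'm) volutive =
  UCat :: "('o, 'm) precategory"
  dual :: "('o, 'm, 'o, 'm) prefunctor"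
  eta :: "('o, 'm, 'o, 'm) pretransformation"

type_synonym ('o, 'm) vol_mor =
  "('o, 'm, 'o, 'm) prefunctor \<times> ('o, 'm, 'o, 'm) pretransformation"

definition volutive_category :: "('o, 'm) volutive \<Rightarrow> bool" where
  "volutive_category V \<longleftrightarrow> volutive_structure (UCat V) (dual V) (eta V)"

definition vol_functor ::
  "('o, 'm) volutive \<Rightarrow> ('o, 'm) volutive \<Rightarrow> ('o, 'm) vol_mor \<Rightarrow> bool" where
  "vol_functor V W M \<longleftrightarrow> (case M of (F, \<alpha>) \<Rightarrow>
     volutive_category V \<and> volutive_category W \<and>
     functor_between (UCat V) (UCat W) F \<and>
     nat_iso (op_functor F \<circ>\<^sub>F dual V) (dual W \<circ>\<^sub>F F) \<alpha> \<and>
     (id_nt F \<circ>\<^sub>H eta V) \<bullet>\<^sub>V (op_nt \<alpha> \<circ>\<^sub>H id_nt (dual V)) =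
     (eta W \<circ>\<^sub>H id_nt F) \<bullet>\<^sub>V (id_nt (op_functor (dual W)) \<circ>\<^sub>H \<alpha>))"

definition vol_trans ::
  "('o, 'm) volutive \<Rightarrow> ('o, 'm) volutive \<Rightarrow> ('o, 'm) vol_mor \<Rightarrow> ('o, 'm) vol_mor \<Rightarrow>
   ('o, 'm, 'o, 'm) pretransformation \<Rightarrow> bool" where
  "vol_trans V W M N \<phi> \<longleftrightarrow> vol_functor V W M \<and> vol_functor V W N \<and>
     (case M of (F1, \<alpha>1) \<Rightarrow> case N of (F2, \<alpha>2) \<Rightarrow>
        nat_trans F1 F2 \<phi> \<and>
        (id_nt (dual W) \<circ>\<^sub>H \<phi>) \<bullet>\<^sub>V \<alpha>1 \<bullet>\<^sub>V (op_nt \<phi> \<circ>\<^sub>H id_nt (dual V)) = \<alpha>2)"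

definition vol_id :: "('o, 'm) volutive \<Rightarrow> ('o, 'm) vol_mor" where
  "vol_id V = (id_functor (UCat V), id_nt (dual V))"

text \<open>
  The composite of \<open>(F, \<alpha>)\<close> and \<open>(G, \<beta>)\<close> carries the pasting
  \<open>G\<^sup>o\<^sup>p F\<^sup>o\<^sup>p d \<Rightarrow> G\<^sup>o\<^sup>p d' F \<Rightarrow> d'' G F\<close>.
\<close>

definition vol_comp :: "('o, 'm) vol_mor \<Rightarrow> ('o, 'm) vol_mor \<Rightarrow> ('o, 'm) vol_mor" where
  "vol_comp N M = (case N of (G, \<beta>) \<Rightarrow> case M of (F, \<alpha>) \<Rightarrow>
     (G \<circ>\<^sub>F F, (\<beta> \<circ>\<^sub>H id_nt F) \<bullet>\<^sub>V (id_nt (op_functor G) \<circ>\<^sub>H \<alpha>)))"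

definition vol_HomCat ::
  "('o, 'm) volutive \<Rightarrow> ('o, 'm) volutive \<Rightarrow>
   (('o, 'm) vol_mor, ('o, 'm, 'o, 'm) pretransformation) precategory" where
  "vol_HomCat V W =
     \<lparr>Obj = {M. vol_functor V W M},
      Hom = (\<lambda>M N. {\<phi>. vol_trans V W M N \<phi>}),
      Idt = (\<lambda>M \<in> {M. vol_functor V W M}. id_nt (fst M)),
      Comp = (\<lambda>L M N \<psi> \<phi>. if vol_trans V W M N \<psi> \<and> vol_trans V W L M \<phi>
        then \<psi> \<bullet>\<^sub>V \<phi> else undefined)\<rparr>"

text \<open>
  The categories range over those with objects in \<open>'o\<close> and morphisms in \<open>'m\<close>: the two types play
  the role of the universe relative to which the 2-category of all (small) categories is formed.
\<close>

definition Cat_O1_vol ::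
  "(('o, 'm) volutive, ('o, 'm) vol_mor, ('o, 'm, 'o, 'm) pretransformation) pre2category" where
  "Cat_O1_vol =
     \<lparr>Obj2 = {V. volutive_category V},
      HomCat = vol_HomCat,
      Unit1 = vol_id,
      HComp = (\<lambda>U V W. let P = prod_cat (vol_HomCat V W) (vol_HomCat U V) in
        \<lparr>Dom = P, Cod = vol_HomCat U W,
         FOb = (\<lambda>(N, M) \<in> Obj P. vol_comp N M),
         FMor = (\<lambda>p q. \<lambda>(\<psi>, \<phi>) \<in> Hom P p q. \<psi> \<circ>\<^sub>H \<phi>)\<rparr>)\<rparr>"


section \<open>Idempotent completion\<close>

text \<open>
  The objects of the idempotent completion are the pairs \<open>(a, e)\<close>, stored along an injection
  \<open>code\<close>. With \<open>code = id\<close> they are literally pairs, of type \<open>'o \<times> 'm\<close>; an injection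
  \<open>code :: 'u \<times> 'u \<Rightarrow> 'u\<close> lets \<open>I\<close> act on categories whose objects and morphisms live
  in one fixed universe \<open>'u\<close>.
\<close>

definition idem_obj :: "('o \<times> 'm \<Rightarrow> 'p) \<Rightarrow> 'p \<Rightarrow> 'o" where
  "idem_obj code x = fst (inv code x)"

definition idem_mor :: "('o \<times> 'm \<Rightarrow> 'p) \<Rightarrow> 'p \<Rightarrow> 'm" where
  "idem_mor code x = snd (inv code x)"

definition idem_compl ::
  "('o \<times> 'm \<Rightarrow> 'p) \<Rightarrow> ('o, 'm) precategory \<Rightarrow> ('p, 'm) precategory" where
  "idem_compl code C =
    (let Ob = code ` {(a, e). a \<in> Obj C \<and> e \<in> Hom C a a \<and> Comp C a a a e e = e};
         H = (\<lambda>x y. if x \<in> Ob \<and> y \<in> Ob then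
               (let a = idem_obj code x; e = idem_mor code x;
                    b = idem_obj code y; f = idem_mor code y
                in {X \<in> Hom C a b. Comp C a b b f X = X \<and> X = Comp C a a b X e})
               else {})
     in \<lparr>Obj = Ob,
         Hom = H,
         Idt = (\<lambda>x \<in> Ob. idem_mor code x),
         Comp = (\<lambda>x y z Y X. if Y \<in> H y z \<and> X \<in> H x y
           then Comp C (idem_obj code x) (idem_obj code y) (idem_obj code z) Y X
           else undefined)\<rparr>)"

text \<open>\<open>I F\<close> sends \<open>(a, e)\<close> to \<open>(F a, F e)\<close> and \<open>X\<close> to \<open>F X\<close>.\<close>

definition idem_functor ::
  "('o \<times> 'm \<Rightarrow> 'p) \<Rightarrow> ('o, 'm, 'o, 'm) prefunctor \<Rightarrow> ('p, 'm, 'p, 'm) prefunctor" where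
  "idem_functor code F =
     \<lparr>Dom = idem_compl code (Dom F), Cod = idem_compl code (Cod F),
      FOb = (\<lambda>x \<in> Obj (idem_compl code (Dom F)). let a = idem_obj code x in
        code (FOb F a, FMor F a a (idem_mor code x))),
      FMor = (\<lambda>x y. \<lambda>X \<in> Hom (idem_compl code (Dom F)) x y.
        FMor F (idem_obj code x) (idem_obj code y) X)\<rparr>"

text \<open>\<open>I \<tau>\<close> has component \<open>\<tau>\<^sub>a \<circ> F e\<close> at \<open>(a, e)\<close>, for \<open>\<tau> : F \<Rightarrow> G\<close>.\<close>

definition idem_nt ::
  "('o \<times> 'm \<Rightarrow> 'p) \<Rightarrow> ('o, 'm, 'o, 'm) pretransformation \<Rightarrow> ('p, 'm, 'p, 'm) pretransformation" where
  "idem_nt code \<tau> =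
     \<lparr>Src = idem_functor code (Src \<tau>), Trg = idem_functor code (Trg \<tau>),
      component = (\<lambda>x \<in> Obj (idem_compl code (Dom (Src \<tau>))). let a = idem_obj code x in
        Comp (Cod (Src \<tau>)) (FOb (Src \<tau>) a) (FOb (Src \<tau>) a) (FOb (Trg \<tau>) a)
          (component \<tau> a) (FMor (Src \<tau>) a a (idem_mor code x)))\<rparr>"

text \<open>
  The idempotent completion of the opposite of \<open>C\<close> is the opposite of the idempotent completion of
  \<open>C\<close>, so \<open>idem_functor code d\<close> is a functor from the latter category to its opposite:
  \<open>d' (a, e) = (d a, d e)\<close>, and \<open>\<eta>'\<close> has component \<open>\<eta>\<^sub>a \<circ> d d e = e \<circ> \<eta>\<^sub>a\<close> at \<open>(a, e)\<close>.
\<close>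

definition idem_volutive :: "('o \<times> 'm \<Rightarrow> 'p) \<Rightarrow> ('o, 'm) volutive \<Rightarrow> ('p, 'm) volutive" where
  "idem_volutive code V =
     \<lparr>UCat = idem_compl code (UCat V), dual = idem_functor code (dual V),
      eta = idem_nt code (eta V)\<rparr>"

definition I_O1 ::
  "('o \<times> 'm \<Rightarrow> 'p) \<Rightarrow>
   (('o, 'm) volutive, ('o, 'm) vol_mor, ('o, 'm, 'o, 'm) pretransformation,
    ('p, 'm) volutive, ('p, 'm) vol_mor, ('p, 'm, 'p, 'm) pretransformation) pre2functor" where
  "I_O1 code =
     \<lparr>FOb2 = idem_volutive code,
      FHom = (\<lambda>V W.
        \<lparr>Dom = vol_HomCat V W,
         Cod = vol_HomCat (idem_volutive code V) (idem_volutive code W),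
         FOb = (\<lambda>(F, \<alpha>) \<in> Obj (vol_HomCat V W). (idem_functor code F, idem_nt code \<alpha>)),
         FMor = (\<lambda>M N. \<lambda>\<phi> \<in> Hom (vol_HomCat V W) M N. idem_nt code \<phi>)\<rparr>)\<rparr>"

end

theory Submission
  imports Defs
begin

text \<open>
  The O(1)-volutive conditions on functors and transformations are unfolded into equations between
  components; these give the 2-category structure by pasting. The idempotent completion is compatible
  with opposites and with vertical and horizontal composition of transformations, so it carries the
  defining equations of volutive functors and transformations to those of their completions. If \<open>g\<close>
  is the inverse of the component \<open>\<tau>\<^sub>a\<close> then \<open>F e \<circ> g\<close> is the inverse of the component
  \<open>\<tau>\<^sub>a \<circ> F e\<close> of the completed transformation at \<open>(a, e)\<close>, because the identity of
  \<open>(a, e)\<close> is \<open>e\<close>.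
\<close>

section \<open>Categories, functors and transformations\<close>

text \<open>\<open>Comp\<close> is \<open>undefined\<close> off its hom-sets, so a composite in
  \<open>idem_compl code C\<close> may be read as one in \<open>C\<close> only once both factors are
  known to be morphisms of the completion. This fixes the order of the arguments about completions:
  membership is established before composites are computed. Associativity is used as a rewrite rule
  that nests composites to the right; a naturality square, the idempotence of \<open>e\<close> or
  the cancellation of an inverse may then be hidden inside a longer composite, hence the variants
  with one more morphism composed on the right. Since \<open>d\<close> reverses arrows, its rules
  are restated with the opposite category computed away, and a component of \<alpha> is treated as a
  morphism \<open>d' (F a) \<rightarrow> F (d a)\<close> of the target category itself. The
  completion is studied for an arbitrary injection \<open>code\<close> into an arbitrary type,
  because the conclusion uses both literal pairs and a coding within one universe.\<close>

lemma op_cat_simps [simp]: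
  "Obj (op_cat C) = Obj C" "Hom (op_cat C) a b = Hom C b a" "Idt (op_cat C) = Idt C"
  "Comp (op_cat C) a b c g f = Comp C c b a f g" "op_cat (op_cat C) = C"
  by (simp_all add: op_cat_def)

lemma op_functor_simps [simp]:
  "Dom (op_functor F) = op_cat (Dom F)" "Cod (op_functor F) = op_cat (Cod F)"
  "FOb (op_functor F) = FOb F" "FMor (op_functor F) a b = FMor F b a"
  "op_functor (op_functor F) = F"
  by (simp_all add: op_functor_def)

lemma id_functor_simps [simp]:
  "Dom (id_functor C) = C" "Cod (id_functor C) = C"
  "a \<in> Obj C \<Longrightarrow> FOb (id_functor C) a = a"
  "f \<in> Hom C a b \<Longrightarrow> FMor (id_functor C) a b f = f"
  by (simp_all add: id_functor_def)

lemma comp_functor_simps [simp]: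
  "Dom (G \<circ>\<^sub>F F) = Dom F" "Cod (G \<circ>\<^sub>F F) = Cod G"
  "a \<in> Obj (Dom F) \<Longrightarrow> FOb (G \<circ>\<^sub>F F) a = FOb G (FOb F a)"
  "f \<in> Hom (Dom F) a b \<Longrightarrow>
    FMor (G \<circ>\<^sub>F F) a b f = FMor G (FOb F a) (FOb F b) (FMor F a b f)"
  by (simp_all add: comp_functor_def)

lemma op_comp_functor: "op_functor (G \<circ>\<^sub>F F) = op_functor G \<circ>\<^sub>F op_functor F"
  by (simp add: op_functor_def comp_functor_def)

lemma op_id_functor: "op_functor (id_functor C) = id_functor (op_cat C)"
  by (simp add: op_functor_def id_functor_def)

lemma op_nt_simps [simp]:
  "Src (op_nt \<tau>) = op_functor (Trg \<tau>)" "Trg (op_nt \<tau>) = op_functor (Src \<tau>)"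
  "component (op_nt \<tau>) = component \<tau>" "op_nt (op_nt \<tau>) = \<tau>"
  by (simp_all add: op_nt_def)

lemma id_nt_simps [simp]:
  "Src (id_nt F) = F" "Trg (id_nt F) = F"
  "a \<in> Obj (Dom F) \<Longrightarrow> component (id_nt F) a = Idt (Cod F) (FOb F a)"
  by (simp_all add: id_nt_def)

lemma vcomp_simps [simp]:
  "Src (\<sigma> \<bullet>\<^sub>V \<tau>) = Src \<tau>" "Trg (\<sigma> \<bullet>\<^sub>V \<tau>) = Trg \<sigma>"
  "a \<in> Obj (Dom (Src \<tau>)) \<Longrightarrow> component (\<sigma> \<bullet>\<^sub>V \<tau>) a =
     Comp (Cod (Src \<tau>)) (FOb (Src \<tau>) a) (FOb (Trg \<tau>) a) (FOb (Trg \<sigma>) a)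
       (component \<sigma> a) (component \<tau> a)"
  by (simp_all add: vcomp_def)

lemma hcomp_simps [simp]:
  "Src (\<sigma> \<circ>\<^sub>H \<tau>) = Src \<sigma> \<circ>\<^sub>F Src \<tau>" "Trg (\<sigma> \<circ>\<^sub>H \<tau>) = Trg \<sigma> \<circ>\<^sub>F Trg \<tau>"
  "a \<in> Obj (Dom (Src \<tau>)) \<Longrightarrow> component (\<sigma> \<circ>\<^sub>H \<tau>) a =
     Comp (Cod (Src \<sigma>)) (FOb (Src \<sigma>) (FOb (Src \<tau>) a)) (FOb (Src \<sigma>) (FOb (Trg \<tau>) a))
       (FOb (Trg \<sigma>) (FOb (Trg \<tau>) a)) (component \<sigma> (FOb (Trg \<tau>) a))
       (FMor (Src \<sigma>) (FOb (Src \<tau>) a) (FOb (Trg \<tau>) a) (component \<tau> a))"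
  by (simp_all add: hcomp_def Let_def)

section \<open>Opposite and product categories\<close>

lemma category_op: "category C \<Longrightarrow> category (op_cat C)"
  by (auto simp: category_def)

lemma category_op_iff [simp]: "category (op_cat C) \<longleftrightarrow> category C"
  using category_op[of C] category_op[of "op_cat C"] by auto

text \<open>The locale axioms as implications from \<open>category C\<close>, so that they can be
  instantiated and handed to the simplifier. Oriented this way, associativity nests every composite
  to the right.\<close>

lemma cat_simps:
  assumes "category C"
  shows "a \<in> Obj C \<Longrightarrow> Idt C a \<in> Hom C a a"
    and "g \<in> Hom C b c \<Longrightarrow> f \<in> Hom C a b \<Longrightarrow> Comp C a b c g f \<in> Hom C a c"
    and "f \<in> Hom C a b \<Longrightarrow> Comp C a a b f (Idt C a) = f"
    and "f \<in> Hom C a b \<Longrightarrow> Comp C a b b (Idt C b) f = f"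
    and "h \<in> Hom C c d \<Longrightarrow> g \<in> Hom C b c \<Longrightarrow> f \<in> Hom C a b \<Longrightarrow>
      Comp C a b d (Comp C b c d h g) f = Comp C a c d h (Comp C a b c g f)"
  using assms by (simp_all add: category_def)

lemma prod_cat_simps [simp]:
  "Obj (prod_cat C D) = Obj C \<times> Obj D"
  "Hom (prod_cat C D) x y = Hom C (fst x) (fst y) \<times> Hom D (snd x) (snd y)"
  "a \<in> Obj C \<Longrightarrow> b \<in> Obj D \<Longrightarrow> Idt (prod_cat C D) (a, b) = (Idt C a, Idt D b)"
  "g \<in> Hom C (fst y) (fst z) \<Longrightarrow> g' \<in> Hom D (snd y) (snd z) \<Longrightarrow>
   f \<in> Hom C (fst x) (fst y) \<Longrightarrow> f' \<in> Hom D (snd x) (snd y) \<Longrightarrow>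
   Comp (prod_cat C D) x y z (g, g') (f, f') =
     (Comp C (fst x) (fst y) (fst z) g f, Comp D (snd x) (snd y) (snd z) g' f')"
  by (simp_all add: prod_cat_def)

lemma category_prod:
  assumes C: "category C" and D: "category D"
  shows "category (prod_cat C D)"
proof
  note [simp] = cat_simps[OF C] cat_simps[OF D]
  note [dest] = category.Hom_Obj[OF C] category.Hom_Obj[OF D]
  show "f \<in> Hom (prod_cat C D) a b \<Longrightarrow> a \<in> Obj (prod_cat C D) \<and> b \<in> Obj (prod_cat C D)" for f a b
    by (cases a; cases b) auto
  show "a \<in> Obj (prod_cat C D) \<Longrightarrow> Idt (prod_cat C D) a \<in> Hom (prod_cat C D) a a" for a
    by auto
  show "Comp (prod_cat C D) a b c g f \<in> Hom (prod_cat C D) a c"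
    if "g \<in> Hom (prod_cat C D) b c" "f \<in> Hom (prod_cat C D) a b" for a b c g f
    using that by auto
  show "Comp (prod_cat C D) a a b f (Idt (prod_cat C D) a) = f"
    "Comp (prod_cat C D) a b b (Idt (prod_cat C D) b) f = f"
    if "f \<in> Hom (prod_cat C D) a b" for a b f
  proof -
    obtain a1 a2 b1 b2 f1 f2 where [simp]: "a = (a1, a2)" "b = (b1, b2)" "f = (f1, f2)"
      by (cases a; cases b; cases f)
    show "Comp (prod_cat C D) a a b f (Idt (prod_cat C D) a) = f"
      "Comp (prod_cat C D) a b b (Idt (prod_cat C D) b) f = f"
      using that category.Hom_Obj[OF C, of f1 a1 b1] category.Hom_Obj[OF D, of f2 a2 b2] by simp_all
  qed
  show "Comp (prod_cat C D) a b d (Comp (prod_cat C D) b c d h g) f =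
      Comp (prod_cat C D) a c d h (Comp (prod_cat C D) a b c g f)"
    if "h \<in> Hom (prod_cat C D) c d" "g \<in> Hom (prod_cat C D) b c" "f \<in> Hom (prod_cat C D) a b"
    for a b c d h g f
    using that by auto
  show "a \<notin> Obj (prod_cat C D) \<Longrightarrow> Idt (prod_cat C D) a = undefined" for a
    by (simp add: prod_cat_def)
  show "Comp (prod_cat C D) a b c g f = undefined"
    if "\<not> (g \<in> Hom (prod_cat C D) b c \<and> f \<in> Hom (prod_cat C D) a b)" for a b c g f
    using that unfolding prod_cat_simps(2) by (auto simp: prod_cat_def)
qed

section \<open>Inverses and isomorphisms\<close>

text \<open>A two-sided inverse is unique, so the definite description behind \<open>inv_mor\<close>
  denotes any inverse that is at hand.\<close>

lemma inv_mor_eq: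
  assumes "category C" "inverse_pair C a b f g"
  shows "inv_mor C a b f = g"
  unfolding inv_mor_def
proof (rule the_equality)
  show "inverse_pair C a b f g" by fact
  fix h assume h: "inverse_pair C a b f h"
  have "h = Comp C b a a (Comp C a b a g f) h"
    using h assms(2) by (simp add: inverse_pair_def cat_simps(4)[OF assms(1)])
  also have "\<dots> = Comp C b b a g (Comp C b a b f h)"
    using h assms by (intro cat_simps(5)) (simp_all add: inverse_pair_def)
  also have "\<dots> = g"
    using h assms(2) by (simp add: inverse_pair_def cat_simps(3)[OF assms(1)])
  finally show "h = g" .
qed

lemma inverse_pair_inv_mor:
  "category C \<Longrightarrow> iso_mor C a b f \<Longrightarrow> inverse_pair C a b f (inv_mor C a b f)"
  unfolding iso_mor_def using inv_mor_eq by fastforce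

lemma iso_mor_Hom: "iso_mor C a b f \<Longrightarrow> f \<in> Hom C a b"
  by (auto simp: iso_mor_def inverse_pair_def)

lemma iso_mor_op [simp]: "iso_mor (op_cat C) a b f \<longleftrightarrow> iso_mor C b a f"
  by (auto simp: iso_mor_def inverse_pair_def)

lemma iso_mor_Idt: "category C \<Longrightarrow> a \<in> Obj C \<Longrightarrow> iso_mor C a a (Idt C a)"
  unfolding iso_mor_def inverse_pair_def by (auto simp: cat_simps intro!: exI[of _ "Idt C a"])

lemma iso_mor_Comp:
  assumes C: "category C" and g: "iso_mor C b c g" and f: "iso_mor C a b f"
  shows "iso_mor C a c (Comp C a b c g f)"
proof -
  note [simp] = cat_simps[OF C]
  obtain g' where g': "g \<in> Hom C b c" "g' \<in> Hom C c b" "Comp C b c b g' g = Idt C b"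
      "Comp C c b c g g' = Idt C c"
    using g by (auto simp: iso_mor_def inverse_pair_def)
  obtain f' where f': "f \<in> Hom C a b" "f' \<in> Hom C b a" "Comp C a b a f' f = Idt C a"
      "Comp C b a b f f' = Idt C b"
    using f by (auto simp: iso_mor_def inverse_pair_def)
  \<comment> \<open>Associativity is turned to the left here, which brings
    \<open>g' \<circ> g\<close> and \<open>f \<circ> f'\<close> together.\<close>
  have "Comp C a c b g' (Comp C a b c g f) = f" "Comp C c a b f (Comp C c b a f' g') = g'"
    using f' g' by (simp_all flip: cat_simps(5)[OF C])
  then have "inverse_pair C a c (Comp C a b c g f) (Comp C c b a f' g')"
    using f' g' by (simp add: inverse_pair_def)
  then show ?thesis
    by (auto simp: iso_mor_def)
qed

section \<open>Functors\<close>

lemma functor_simps: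
  assumes "functor_between C D F"
  shows "Dom F = C" "Cod F = D"
    and "a \<in> Obj C \<Longrightarrow> FOb F a \<in> Obj D"
    and "f \<in> Hom C a b \<Longrightarrow> FMor F a b f \<in> Hom D (FOb F a) (FOb F b)"
    and "a \<in> Obj C \<Longrightarrow> FMor F a a (Idt C a) = Idt D (FOb F a)"
    and "g \<in> Hom C b c \<Longrightarrow> f \<in> Hom C a b \<Longrightarrow> FMor F a c (Comp C a b c g f) =
      Comp D (FOb F a) (FOb F b) (FOb F c) (FMor F b c g) (FMor F a b f)"
  using assms by (auto simp: functor_between_def is_functor_def)

lemma functor_cats:
  assumes "functor_between C D F"
  shows "category C" "category D"
  using assms by (auto simp: functor_between_def is_functor_def)

lemma functor_ext:
  assumes "functor_between C D F"
  shows "a \<notin> Obj C \<Longrightarrow> FOb F a = undefined" "f \<notin> Hom C a b \<Longrightarrow> FMor F a b f = undefined"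
  using assms unfolding functor_between_def is_functor_def by (blast dest: PiE_arb)+

text \<open>A morphism has its endpoints among the objects, so the goals about morphisms may assume
  this of the endpoints; the rules for values of functors on objects ask for exactly that.\<close>

lemma functor_betweenI:
  assumes C: "category C" and "category D" and "Dom F = C" "Cod F = D"
    and "\<And>a. a \<in> Obj C \<Longrightarrow> FOb F a \<in> Obj D"
    and "\<And>a. a \<notin> Obj C \<Longrightarrow> FOb F a = undefined"
    and Mor: "\<And>a b f. a \<in> Obj C \<Longrightarrow> b \<in> Obj C \<Longrightarrow> f \<in> Hom C a b \<Longrightarrow>
      FMor F a b f \<in> Hom D (FOb F a) (FOb F b)"
    and "\<And>a b f. f \<notin> Hom C a b \<Longrightarrow> FMor F a b f = undefined"
    and "\<And>a. a \<in> Obj C \<Longrightarrow> FMor F a a (Idt C a) = Idt D (FOb F a)"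
    and Cmp: "\<And>a b c g f. a \<in> Obj C \<Longrightarrow> b \<in> Obj C \<Longrightarrow> c \<in> Obj C \<Longrightarrow>
      g \<in> Hom C b c \<Longrightarrow> f \<in> Hom C a b \<Longrightarrow> FMor F a c (Comp C a b c g f) =
      Comp D (FOb F a) (FOb F b) (FOb F c) (FMor F b c g) (FMor F a b f)"
  shows "functor_between C D F"
proof -
  note [dest] = category.Hom_Obj[OF C]
  have "\<And>a b f. f \<in> Hom C a b \<Longrightarrow> FMor F a b f \<in> Hom D (FOb F a) (FOb F b)"
    using Mor by blast
  moreover have "\<And>a b c g f. g \<in> Hom C b c \<Longrightarrow> f \<in> Hom C a b \<Longrightarrow> FMor F a c (Comp C a b c g f) =
      Comp D (FOb F a) (FOb F b) (FOb F c) (FMor F b c g) (FMor F a b f)"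
    using Cmp by blast
  ultimately show ?thesis
    using assms(1-6,8-9) by (simp add: functor_between_def is_functor_def PiE_iff extensional_def)
qed

text \<open>Domain and codomain are prescribed and both functors are \<open>undefined\<close> off
  their domain, so agreement on the objects and morphisms of \<open>C\<close> is equality of
  records.\<close>

lemma functor_eqI:
  assumes F: "functor_between C D F" and G: "functor_between C D G"
    and Ob: "\<And>a. a \<in> Obj C \<Longrightarrow> FOb F a = FOb G a"
    and Mor: "\<And>a b f. a \<in> Obj C \<Longrightarrow> b \<in> Obj C \<Longrightarrow> f \<in> Hom C a b \<Longrightarrow> FMor F a b f = FMor G a b f"
  shows "F = G"
proof (rule prefunctor.equality)
  show "FOb F = FOb G"
    using Ob functor_ext(1)[OF F] functor_ext(1)[OF G] by (metis ext)
  show "FMor F = FMor G"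
    using Mor functor_ext(2)[OF F] functor_ext(2)[OF G] category.Hom_Obj[OF functor_cats(1)[OF F]]
    by (intro ext) metis
qed (simp_all add: functor_simps(1,2)[OF F] functor_simps(1,2)[OF G])

lemma functor_op: "functor_between C D F \<Longrightarrow> functor_between (op_cat C) (op_cat D) (op_functor F)"
  by (rule functor_betweenI) (simp_all add: functor_simps functor_cats functor_ext)

lemma functor_id: "category C \<Longrightarrow> functor_between C C (id_functor C)"
  by (rule functor_betweenI) (simp_all add: cat_simps id_functor_def)

lemma functor_comp:
  assumes F: "functor_between C D F" and G: "functor_between D E G"
  shows "functor_between C E (G \<circ>\<^sub>F F)"
proof (rule functor_betweenI)
  note [simp] = functor_simps[OF F] functor_simps[OF G] cat_simps[OF functor_cats(1)[OF F]]
  show "category C" "category E" "Dom (G \<circ>\<^sub>F F) = C" "Cod (G \<circ>\<^sub>F F) = E"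
    using F G by (simp_all add: functor_cats)
  show "a \<notin> Obj C \<Longrightarrow> FOb (G \<circ>\<^sub>F F) a = undefined" for a
    by (simp add: comp_functor_def)
  show "f \<notin> Hom C a b \<Longrightarrow> FMor (G \<circ>\<^sub>F F) a b f = undefined" for a b f
    by (simp add: comp_functor_def)
qed (simp_all add: functor_simps[OF F] functor_simps[OF G] cat_simps[OF functor_cats(1)[OF F]])

lemma comp_functor_assoc:
  assumes F: "functor_between B C F" and G: "functor_between C D G" and H: "functor_between D E H"
  shows "(H \<circ>\<^sub>F G) \<circ>\<^sub>F F = H \<circ>\<^sub>F (G \<circ>\<^sub>F F)"
  by (rule functor_eqI[of B E])
    (use F G H in \<open>auto intro: functor_comp simp: functor_simps[OF F] functor_simps[OF G]\<close>)

lemma comp_functor_id: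
  assumes F: "functor_between C D F"
  shows "F \<circ>\<^sub>F id_functor C = F" "id_functor D \<circ>\<^sub>F F = F"
  by (rule functor_eqI[of C D],
      use F in \<open>auto intro: functor_comp functor_id functor_cats simp: functor_simps[OF F]\<close>)+

section \<open>Natural transformations and interchange\<close>

text \<open>\<open>nat_trans\<close> mentions the two categories only as fields of the functors.
  Naming them as parameters lets rules about transformations be instantiated without first
  evaluating \<open>Dom\<close> and \<open>Cod\<close> of composite functors.\<close>

definition nt_between ::
  "('o, 'm) precategory \<Rightarrow> ('p, 'n) precategory \<Rightarrow> ('o, 'm, 'p, 'n) prefunctor \<Rightarrow>
   ('o, 'm, 'p, 'n) prefunctor \<Rightarrow> ('o, 'm, 'p, 'n) pretransformation \<Rightarrow> bool" where
  "nt_between C D F G \<tau> \<longleftrightarrow> functor_between C D F \<and> functor_between C D G \<and> nat_trans F G \<tau>"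

lemma nt_functors:
  assumes "nt_between C D F G \<tau>"
  shows "functor_between C D F" "functor_between C D G"
  using assms by (auto simp: nt_between_def)

lemma nt_simps:
  assumes "nt_between C D F G \<tau>"
  shows "Src \<tau> = F" "Trg \<tau> = G"
    and "a \<in> Obj C \<Longrightarrow> component \<tau> a \<in> Hom D (FOb F a) (FOb G a)"
  using assms by (auto simp: nt_between_def nat_trans_def functor_between_def)

lemma nt_natural:
  assumes "nt_between C D F G \<tau>" and "f \<in> Hom C a b"
  shows "Comp D (FOb F a) (FOb F b) (FOb G b) (component \<tau> b) (FMor F a b f) =
    Comp D (FOb F a) (FOb G a) (FOb G b) (FMor G a b f) (component \<tau> a)"
  using assms by (auto simp: nt_between_def nat_trans_def functor_between_def)

text \<open>Inside a composite nested to the right, a naturality square occurs with a further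
  morphism \<open>k\<close> on its right unless it is the innermost part; this is its form as a
  rewrite rule there.\<close>

lemma nt_natural_comp:
  assumes \<tau>: "nt_between C D F G \<tau>" and f: "f \<in> Hom C a b" and k: "k \<in> Hom D z (FOb F a)"
  shows "Comp D z (FOb F b) (FOb G b) (component \<tau> b) (Comp D z (FOb F a) (FOb F b) (FMor F a b f) k) =
    Comp D z (FOb G a) (FOb G b) (FMor G a b f) (Comp D z (FOb F a) (FOb G a) (component \<tau> a) k)"
proof -
  note F = nt_functors(1)[OF \<tau>] and G = nt_functors(2)[OF \<tau>]
  have "a \<in> Obj C" "b \<in> Obj C"
    using category.Hom_Obj[OF functor_cats(1)[OF F] f] by auto
  then show ?thesis
    using f k nt_simps[OF \<tau>]
    by (simp add: functor_simps[OF F] functor_simps[OF G] nt_natural[OF \<tau>]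
        flip: cat_simps(5)[OF functor_cats(2)[OF F]])
qed

lemma nt_ext: "nt_between C D F G \<tau> \<Longrightarrow> a \<notin> Obj C \<Longrightarrow> component \<tau> a = undefined"
  unfolding nt_between_def nat_trans_def functor_between_def by (blast dest: PiE_arb)

lemma nt_betweenI:
  assumes F: "functor_between C D F" and G: "functor_between C D G"
    and "Src \<tau> = F" "Trg \<tau> = G"
    and "\<And>a. a \<in> Obj C \<Longrightarrow> component \<tau> a \<in> Hom D (FOb F a) (FOb G a)"
    and "\<And>a. a \<notin> Obj C \<Longrightarrow> component \<tau> a = undefined"
    and nat: "\<And>a b f. a \<in> Obj C \<Longrightarrow> b \<in> Obj C \<Longrightarrow> f \<in> Hom C a b \<Longrightarrow>
      Comp D (FOb F a) (FOb F b) (FOb G b) (component \<tau> b) (FMor F a b f) =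
      Comp D (FOb F a) (FOb G a) (FOb G b) (FMor G a b f) (component \<tau> a)"
  shows "nt_between C D F G \<tau>"
proof -
  have "\<And>a b f. f \<in> Hom C a b \<Longrightarrow>
      Comp D (FOb F a) (FOb F b) (FOb G b) (component \<tau> b) (FMor F a b f) =
      Comp D (FOb F a) (FOb G a) (FOb G b) (FMor G a b f) (component \<tau> a)"
    using nat category.Hom_Obj[OF functor_cats(1)[OF F]] by blast
  then show ?thesis
    using assms(1-6) by (simp add: nt_between_def nat_trans_def functor_between_def PiE_iff
      extensional_def)
qed

text \<open>Source and target are fixed by the typing, so an identity of transformations splits into
  typing both sides with the same functors and comparing components. The first half is where
  associativity of functor composition enters.\<close>

lemma nt_eqI:
  assumes \<sigma>: "nt_between C D F G \<sigma>" and \<tau>: "nt_between C D F G \<tau>"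
    and comp: "\<And>a. a \<in> Obj C \<Longrightarrow> component \<sigma> a = component \<tau> a"
  shows "\<sigma> = \<tau>"
proof (rule pretransformation.equality)
  show "component \<sigma> = component \<tau>"
    using comp nt_ext[OF \<sigma>] nt_ext[OF \<tau>] by (metis ext)
qed (simp_all add: nt_simps[OF \<sigma>] nt_simps[OF \<tau>])

lemma nt_op:
  assumes \<tau>: "nt_between C D F G \<tau>"
  shows "nt_between (op_cat C) (op_cat D) (op_functor G) (op_functor F) (op_nt \<tau>)"
  by (rule nt_betweenI)
    (simp_all add: nt_functors[OF \<tau>] functor_op nt_simps[OF \<tau>] nt_ext[OF \<tau>] nt_natural[OF \<tau>])

lemma nt_id:
  assumes F: "functor_between C D F"
  shows "nt_between C D F F (id_nt F)"
  by (rule nt_betweenI)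
    (simp_all add: F functor_simps[OF F] cat_simps[OF functor_cats(2)[OF F]] id_nt_def)

lemma nt_vcomp:
  assumes \<sigma>: "nt_between C D G H \<sigma>" and \<tau>: "nt_between C D F G \<tau>"
  shows "nt_between C D F H (\<sigma> \<bullet>\<^sub>V \<tau>)"
proof (rule nt_betweenI)
  note F = nt_functors(1)[OF \<tau>] and G = nt_functors(2)[OF \<tau>] and H = nt_functors(2)[OF \<sigma>]
  note [simp] = functor_simps[OF F] functor_simps[OF G] functor_simps[OF H]
    cat_simps[OF functor_cats(2)[OF F]] nt_simps[OF \<sigma>] nt_simps[OF \<tau>]
  show "functor_between C D F" "functor_between C D H" "Src (\<sigma> \<bullet>\<^sub>V \<tau>) = F" "Trg (\<sigma> \<bullet>\<^sub>V \<tau>) = H"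
    by (simp_all add: F H)
  show "a \<notin> Obj C \<Longrightarrow> component (\<sigma> \<bullet>\<^sub>V \<tau>) a = undefined" for a
    by (simp add: vcomp_def)
  show "component (\<sigma> \<bullet>\<^sub>V \<tau>) a \<in> Hom D (FOb F a) (FOb H a)" if "a \<in> Obj C" for a
    using that by simp
  show "Comp D (FOb F a) (FOb F b) (FOb H b) (component (\<sigma> \<bullet>\<^sub>V \<tau>) b) (FMor F a b f) =
      Comp D (FOb F a) (FOb H a) (FOb H b) (FMor H a b f) (component (\<sigma> \<bullet>\<^sub>V \<tau>) a)"
    if "a \<in> Obj C" "b \<in> Obj C" "f \<in> Hom C a b" for a b f
    using that by (simp add: nt_natural[OF \<tau>] nt_natural_comp[OF \<sigma>])
qed

lemma nt_hcomp:
  assumes \<sigma>: "nt_between D E G G' \<sigma>" and \<tau>: "nt_between C D F F' \<tau>"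
  shows "nt_between C E (G \<circ>\<^sub>F F) (G' \<circ>\<^sub>F F') (\<sigma> \<circ>\<^sub>H \<tau>)"
proof (rule nt_betweenI)
  note F = nt_functors(1)[OF \<tau>] and F' = nt_functors(2)[OF \<tau>]
    and G = nt_functors(1)[OF \<sigma>] and G' = nt_functors(2)[OF \<sigma>]
  note [simp] = functor_simps[OF F] functor_simps[OF F'] functor_simps[OF G] functor_simps[OF G']
    cat_simps[OF functor_cats(2)[OF F]] cat_simps[OF functor_cats(2)[OF G]] nt_simps[OF \<sigma>]
      nt_simps[OF \<tau>]
  show "functor_between C E (G \<circ>\<^sub>F F)" "functor_between C E (G' \<circ>\<^sub>F F')"
    "Src (\<sigma> \<circ>\<^sub>H \<tau>) = G \<circ>\<^sub>F F" "Trg (\<sigma> \<circ>\<^sub>H \<tau>) = G' \<circ>\<^sub>F F'"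
    by (simp_all add: functor_comp[OF F G] functor_comp[OF F' G'])
  show "a \<notin> Obj C \<Longrightarrow> component (\<sigma> \<circ>\<^sub>H \<tau>) a = undefined" for a
    by (simp add: hcomp_def)
  show "component (\<sigma> \<circ>\<^sub>H \<tau>) a \<in> Hom E (FOb (G \<circ>\<^sub>F F) a) (FOb (G' \<circ>\<^sub>F F') a)" if "a \<in> Obj C" for a
    using that by simp
  show "Comp E (FOb (G \<circ>\<^sub>F F) a) (FOb (G \<circ>\<^sub>F F) b) (FOb (G' \<circ>\<^sub>F F') b)
       (component (\<sigma> \<circ>\<^sub>H \<tau>) b) (FMor (G \<circ>\<^sub>F F) a b f) =
     Comp E (FOb (G \<circ>\<^sub>F F) a) (FOb (G' \<circ>\<^sub>F F') a) (FOb (G' \<circ>\<^sub>F F') b)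
       (FMor (G' \<circ>\<^sub>F F') a b f) (component (\<sigma> \<circ>\<^sub>H \<tau>) a)"
    if "a \<in> Obj C" "b \<in> Obj C" "f \<in> Hom C a b" for a b f
    \<comment> \<open>The naturality square of \<tau> at \<open>f\<close> is mapped by
      \<open>G\<close>; naturality of \<sigma> then carries the result across.\<close>
    using that arg_cong[OF nt_natural[OF \<tau> that(3)], of "FMor G (FOb F a) (FOb F' b)"]
    by (simp add: nt_natural_comp[OF \<sigma>])
qed

lemma vcomp_assoc:
  assumes \<rho>: "nt_between C D H K \<rho>" and \<sigma>: "nt_between C D G H \<sigma>" and \<tau>: "nt_between C D F G \<tau>"
  shows "(\<rho> \<bullet>\<^sub>V \<sigma>) \<bullet>\<^sub>V \<tau> = \<rho> \<bullet>\<^sub>V (\<sigma> \<bullet>\<^sub>V \<tau>)"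
  by (rule nt_eqI[of C D F K])
    (use assms in \<open>auto intro!: nt_vcomp intro: nt_functors simp: nt_simps[OF \<rho>]
      nt_simps[OF \<sigma>] nt_simps[OF \<tau>]
      functor_simps(1,2)[OF nt_functors(1)[OF \<tau>]] functor_simps(1,2)[OF nt_functors(1)[OF \<sigma>]]
      cat_simps[OF functor_cats(2)[OF nt_functors(1)[OF \<tau>]]]\<close>)

lemma vcomp_id:
  assumes \<tau>: "nt_between C D F G \<tau>"
  shows "\<tau> \<bullet>\<^sub>V id_nt F = \<tau>" "id_nt G \<bullet>\<^sub>V \<tau> = \<tau>"
proof -
  note F = nt_functors(1)[OF \<tau>] and G = nt_functors(2)[OF \<tau>]
  note [simp] = nt_simps[OF \<tau>] functor_simps(1,2)[OF F] functor_simps(1,2)[OF G]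
    cat_simps[OF functor_cats(2)[OF F]]
  show "\<tau> \<bullet>\<^sub>V id_nt F = \<tau>"
    by (rule nt_eqI[OF nt_vcomp[OF \<tau> nt_id[OF F]] \<tau>]) simp
  show "id_nt G \<bullet>\<^sub>V \<tau> = \<tau>"
    by (rule nt_eqI[OF nt_vcomp[OF nt_id[OF G] \<tau>] \<tau>]) simp
qed

lemma hcomp_assoc:
  assumes \<rho>: "nt_between D E H H' \<rho>" and \<sigma>: "nt_between C D G G' \<sigma>" and \<tau>: "nt_between B C F F' \<tau>"
  shows "(\<rho> \<circ>\<^sub>H \<sigma>) \<circ>\<^sub>H \<tau> = \<rho> \<circ>\<^sub>H (\<sigma> \<circ>\<^sub>H \<tau>)"
proof -
  note F = nt_functors(1)[OF \<tau>] and F' = nt_functors(2)[OF \<tau>]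
    and G = nt_functors(1)[OF \<sigma>] and G' = nt_functors(2)[OF \<sigma>]
    and H = nt_functors(1)[OF \<rho>] and H' = nt_functors(2)[OF \<rho>]
  note [simp] = nt_simps[OF \<tau>] nt_simps[OF \<sigma>] nt_simps[OF \<rho>]
    functor_simps[OF F] functor_simps[OF F'] functor_simps[OF G] functor_simps[OF G']
    functor_simps[OF H] functor_simps[OF H']
    cat_simps[OF functor_cats(2)[OF H]]
  \<comment> \<open>The ends of the two bracketings agree only by associativity of functor
    composition; the right-hand side is retyped so that both run between the same functors.\<close>
  have "nt_between B E (H \<circ>\<^sub>F G \<circ>\<^sub>F F) (H' \<circ>\<^sub>F G' \<circ>\<^sub>F F') (\<rho> \<circ>\<^sub>H (\<sigma> \<circ>\<^sub>H \<tau>))"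
    unfolding comp_functor_assoc[OF F G H] comp_functor_assoc[OF F' G' H']
    by (rule nt_hcomp[OF \<rho> nt_hcomp[OF \<sigma> \<tau>]])
  then show ?thesis
    by (rule nt_eqI[OF nt_hcomp[OF nt_hcomp[OF \<rho> \<sigma>] \<tau>]]) simp
qed

lemma hcomp_id:
  assumes \<tau>: "nt_between C D F G \<tau>"
  shows "\<tau> \<circ>\<^sub>H id_nt (id_functor C) = \<tau>" "id_nt (id_functor D) \<circ>\<^sub>H \<tau> = \<tau>"
proof -
  note F = nt_functors(1)[OF \<tau>] and G = nt_functors(2)[OF \<tau>]
  note [simp] = nt_simps[OF \<tau>] functor_simps[OF F] functor_simps[OF G]
    cat_simps[OF functor_cats(2)[OF F]]
  show "\<tau> \<circ>\<^sub>H id_nt (id_functor C) = \<tau>"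
    by (rule nt_eqI[OF nt_hcomp[OF \<tau> nt_id[OF functor_id], unfolded comp_functor_id[OF F]
      comp_functor_id[OF G]] \<tau>])
      (simp_all add: functor_cats[OF F])
  show "id_nt (id_functor D) \<circ>\<^sub>H \<tau> = \<tau>"
    by (rule nt_eqI[OF nt_hcomp[OF nt_id[OF functor_id] \<tau>, unfolded comp_functor_id[OF F]
      comp_functor_id[OF G]] \<tau>])
      (simp_all add: functor_cats[OF F])
qed

lemma id_nt_hcomp:
  assumes F: "functor_between C D F" and G: "functor_between D E G"
  shows "id_nt G \<circ>\<^sub>H id_nt F = id_nt (G \<circ>\<^sub>F F)"
  by (rule nt_eqI[OF nt_hcomp[OF nt_id[OF G] nt_id[OF F]] nt_id[OF functor_comp[OF F G]]])
    (simp add: functor_simps[OF F] functor_simps[OF G] cat_simps[OF functor_cats(2)[OF G]]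
      cat_simps[OF functor_cats(2)[OF F]])

text \<open>The two sides differ in whether \<sigma> is applied after or before the component of
  \<open>\<tau>'\<close>; the naturality square of \<sigma> at that component identifies
  them.\<close>

lemma interchange:
  assumes \<sigma>': "nt_between D E G' G'' \<sigma>'" and \<sigma>: "nt_between D E G G' \<sigma>"
    and \<tau>': "nt_between C D F' F'' \<tau>'" and \<tau>: "nt_between C D F F' \<tau>"
  shows "(\<sigma>' \<bullet>\<^sub>V \<sigma>) \<circ>\<^sub>H (\<tau>' \<bullet>\<^sub>V \<tau>) = (\<sigma>' \<circ>\<^sub>H \<tau>') \<bullet>\<^sub>V (\<sigma> \<circ>\<^sub>H \<tau>)"
proof (rule nt_eqI[OF nt_hcomp[OF nt_vcomp[OF \<sigma>' \<sigma>] nt_vcomp[OF \<tau>' \<tau>]]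
      nt_vcomp[OF nt_hcomp[OF \<sigma>' \<tau>'] nt_hcomp[OF \<sigma> \<tau>]]])
  note F = nt_functors(1)[OF \<tau>] and F' = nt_functors(2)[OF \<tau>] and F'' = nt_functors(2)[OF \<tau>']
    and G = nt_functors(1)[OF \<sigma>] and G' = nt_functors(2)[OF \<sigma>] and G'' = nt_functors(2)[OF \<sigma>']
  note [simp] = nt_simps[OF \<tau>] nt_simps[OF \<sigma>] nt_simps[OF \<tau>'] nt_simps[OF \<sigma>']
    functor_simps[OF F] functor_simps[OF F'] functor_simps[OF G] functor_simps[OF G']
    functor_simps[OF F''] functor_simps[OF G'']
    cat_simps[OF functor_cats(2)[OF G]] cat_simps[OF functor_cats(2)[OF F]]
  show "component ((\<sigma>' \<bullet>\<^sub>V \<sigma>) \<circ>\<^sub>H (\<tau>' \<bullet>\<^sub>V \<tau>)) a = component ((\<sigma>' \<circ>\<^sub>H \<tau>') \<bullet>\<^sub>V (\<sigma> \<circ>\<^sub>H \<tau>)) a"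
    if "a \<in> Obj C" for a
    using that by (simp add: nt_natural_comp[OF \<sigma>])
qed

section \<open>Contravariant functors and double duals\<close>

text \<open>The general rules for a functor into \<open>op_cat D\<close> speak of hom-sets of the
  opposite category, which the simplifier rewrites to hom-sets of \<open>D\<close>; here they are
  given in that normal form.\<close>

lemma contra_simps:
  assumes "functor_between C (op_cat D) F"
  shows "Dom F = C" "Cod F = op_cat D"
    and "a \<in> Obj C \<Longrightarrow> FOb F a \<in> Obj D"
    and "f \<in> Hom C a b \<Longrightarrow> FMor F a b f \<in> Hom D (FOb F b) (FOb F a)"
    and "a \<in> Obj C \<Longrightarrow> FMor F a a (Idt C a) = Idt D (FOb F a)"
    and "g \<in> Hom C b c \<Longrightarrow> f \<in> Hom C a b \<Longrightarrow> FMor F a c (Comp C a b c g f) =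
      Comp D (FOb F c) (FOb F b) (FOb F a) (FMor F a b f) (FMor F b c g)"
  using functor_simps[OF assms] by simp_all

lemma nat_iso_iff:
  assumes "functor_between C D F" "functor_between C D G"
  shows "nat_iso F G \<tau> \<longleftrightarrow>
    nt_between C D F G \<tau> \<and> (\<forall>a \<in> Obj C. iso_mor D (FOb F a) (FOb G a) (component \<tau> a))"
  using assms by (auto simp: nat_iso_def nt_between_def functor_simps)

lemma functor_double_dual:
  "functor_between C (op_cat C) d \<Longrightarrow> functor_between C C (op_functor d \<circ>\<^sub>F d)"
  using functor_comp functor_op by fastforce

section \<open>The 2-category of volutive categories\<close>

text \<open>The coherence law is an equation with \<open>inv_mor\<close>, a description that carries
  information only once an inverse exists. Given that all components of \<eta> are isomorphisms, it
  becomes a pair of equations between composites, which can be computed with.\<close>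

lemma volutive_structure_iff:
  "volutive_structure C d \<eta> \<longleftrightarrow> functor_between C (op_cat C) d \<and>
     nt_between C C (op_functor d \<circ>\<^sub>F d) (id_functor C) \<eta> \<and>
     (\<forall>a \<in> Obj C. iso_mor C (FOb d (FOb d a)) a (component \<eta> a)) \<and>
     (\<forall>a \<in> Obj C. inverse_pair C (FOb d (FOb d (FOb d a))) (FOb d a) (component \<eta> (FOb d a))
        (FMor d (FOb d (FOb d a)) a (component \<eta> a)))"
proof (cases "functor_between C (op_cat C) d")
  case d: True
  then have C: "category C" and dd: "functor_between C C (op_functor d \<circ>\<^sub>F d)"
    by (auto simp: functor_cats functor_double_dual)
  note [simp] = contra_simps[OF d]
  \<comment> \<open>From left to right, the component at \<open>d a\<close> is invertible and so
    \<open>inv_mor\<close> is a true inverse; from right to left, inverses are unique.\<close>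
  have inv: "FMor d (FOb d (FOb d a)) a (component \<eta> a) =
        inv_mor C (FOb d (FOb d (FOb d a))) (FOb d a) (component \<eta> (FOb d a)) \<longleftrightarrow>
      inverse_pair C (FOb d (FOb d (FOb d a))) (FOb d a) (component \<eta> (FOb d a))
        (FMor d (FOb d (FOb d a)) a (component \<eta> a))"
    if "a \<in> Obj C" "\<forall>a \<in> Obj C. iso_mor C (FOb d (FOb d a)) a (component \<eta> a)" for a
    using that inverse_pair_inv_mor[OF C] inv_mor_eq[OF C] by (metis contra_simps(3) d)
  show ?thesis
    unfolding volutive_structure_def nat_iso_iff[OF dd functor_id[OF C]] Let_def
    using inv C d by (auto simp del: contra_simps)
next
  case False
  then show ?thesis
    by (simp add: volutive_structure_def)
qed

lemma volutive_category_simps: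
  assumes V: "volutive_category V"
  shows "category (UCat V)"
    and "functor_between (UCat V) (op_cat (UCat V)) (dual V)"
    and "nt_between (UCat V) (UCat V) (op_functor (dual V) \<circ>\<^sub>F dual V) (id_functor (UCat V)) (eta V)"
    and "a \<in> Obj (UCat V) \<Longrightarrow>
      component (eta V) a \<in> Hom (UCat V) (FOb (dual V) (FOb (dual V) a)) a"
proof -
  note * = V[unfolded volutive_category_def volutive_structure_iff]
  show d: "functor_between (UCat V) (op_cat (UCat V)) (dual V)"
    using * by blast
  show "category (UCat V)"
    using functor_cats(1)[OF d] .
  show "nt_between (UCat V) (UCat V) (op_functor (dual V) \<circ>\<^sub>F dual V) (id_functor (UCat V)) (eta V)"
    using * by blast
  show "component (eta V) a \<in> Hom (UCat V) (FOb (dual V) (FOb (dual V) a)) a"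
    if "a \<in> Obj (UCat V)"
    using * that by (blast dest: iso_mor_Hom)
qed

text \<open>A transformation into \<open>op_cat D\<close> has components that run backwards in
  \<open>D\<close>; typing and naturality are spelled out in \<open>D\<close>, with the square
  reversed accordingly.\<close>

lemma contra_nt_simps:
  assumes F: "functor_between C D F" and d: "functor_between C (op_cat C) d"
    and d': "functor_between D (op_cat D) d'"
    and \<alpha>: "nt_between C (op_cat D) (op_functor F \<circ>\<^sub>F d) (d' \<circ>\<^sub>F F) \<alpha>"
  shows "Src \<alpha> = op_functor F \<circ>\<^sub>F d" "Trg \<alpha> = d' \<circ>\<^sub>F F"
    and "a \<in> Obj C \<Longrightarrow> component \<alpha> a \<in> Hom D (FOb d' (FOb F a)) (FOb F (FOb d a))"
    and "f \<in> Hom C a b \<Longrightarrow>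
      Comp D (FOb d' (FOb F b)) (FOb F (FOb d b)) (FOb F (FOb d a))
        (FMor F (FOb d b) (FOb d a) (FMor d a b f)) (component \<alpha> b) =
      Comp D (FOb d' (FOb F b)) (FOb d' (FOb F a)) (FOb F (FOb d a))
        (component \<alpha> a) (FMor d' (FOb F a) (FOb F b) (FMor F a b f))"
proof -
  show "Src \<alpha> = op_functor F \<circ>\<^sub>F d" "Trg \<alpha> = d' \<circ>\<^sub>F F"
    by (simp_all add: nt_simps[OF \<alpha>])
  show "component \<alpha> a \<in> Hom D (FOb d' (FOb F a)) (FOb F (FOb d a))" if "a \<in> Obj C"
    using nt_simps(3)[OF \<alpha> that] that by (simp add: contra_simps[OF d] functor_simps[OF F])
  show "Comp D (FOb d' (FOb F b)) (FOb F (FOb d b)) (FOb F (FOb d a))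
        (FMor F (FOb d b) (FOb d a) (FMor d a b f)) (component \<alpha> b) =
      Comp D (FOb d' (FOb F b)) (FOb d' (FOb F a)) (FOb F (FOb d a))
        (component \<alpha> a) (FMor d' (FOb F a) (FOb F b) (FMor F a b f))"
    if f: "f \<in> Hom C a b"
  proof -
    have "a \<in> Obj C" "b \<in> Obj C"
      using category.Hom_Obj[OF functor_cats(1)[OF F] f] by auto
    then show ?thesis
      using nt_natural[OF \<alpha> f] f by (simp add: contra_simps[OF d] functor_simps[OF F])
  qed
qed

text \<open>Transformations with the same ends are equal when their components are, so the pasting
  law may be tested at each object, where it reads \<open>F (\<eta> a) \<circ> \<alpha> (d a) =
  \<eta>' (F a) \<circ> d' (\<alpha> a)\<close>.\<close>

lemma vol_functor_iff:
  "vol_functor V W (F, \<alpha>) \<longleftrightarrow> volutive_category V \<and> volutive_category W \<and>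
     functor_between (UCat V) (UCat W) F \<and>
     nt_between (UCat V) (op_cat (UCat W)) (op_functor F \<circ>\<^sub>F dual V) (dual W \<circ>\<^sub>F F) \<alpha> \<and>
     (\<forall>a \<in> Obj (UCat V).
        iso_mor (UCat W) (FOb (dual W) (FOb F a)) (FOb F (FOb (dual V) a)) (component \<alpha> a)) \<and>
     (\<forall>a \<in> Obj (UCat V).
        Comp (UCat W) (FOb (dual W) (FOb F (FOb (dual V) a))) (FOb F (FOb (dual V) (FOb (dual V) a)))
          (FOb F a) (FMor F (FOb (dual V) (FOb (dual V) a)) a (component (eta V) a))
          (component \<alpha> (FOb (dual V) a)) =
        Comp (UCat W) (FOb (dual W) (FOb F (FOb (dual V) a))) (FOb (dual W) (FOb (dual W) (FOb F a)))
          (FOb F a) (component (eta W) (FOb F a))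
          (FMor (dual W) (FOb (dual W) (FOb F a)) (FOb F (FOb (dual V) a)) (component \<alpha> a)))"
proof (cases "volutive_category V \<and> volutive_category W \<and> functor_between (UCat V) (UCat W) F")
  case False
  then show ?thesis
    by (auto simp: vol_functor_def)
next
  case True
  then have V: "volutive_category V" and W: "volutive_category W"
    and F: "functor_between (UCat V) (UCat W) F"
    by auto
  note dV = volutive_category_simps(2)[OF V] and dW = volutive_category_simps(2)[OF W]
    and eV = volutive_category_simps(3)[OF V] and eW = volutive_category_simps(3)[OF W]
  have Fd: "functor_between (UCat V) (op_cat (UCat W)) (op_functor F \<circ>\<^sub>F dual V)"
    using functor_comp[OF dV functor_op[OF F]] .
  have dF: "functor_between (UCat V) (op_cat (UCat W)) (dual W \<circ>\<^sub>F F)"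
    using functor_comp[OF F dW] .
  note [simp] = contra_simps[OF dV] contra_simps[OF dW] functor_simps[OF F]
  show ?thesis
  proof (cases "nt_between (UCat V) (op_cat (UCat W)) (op_functor F \<circ>\<^sub>F dual V) (dual W \<circ>\<^sub>F F) \<alpha>")
    case False
    then show ?thesis
      unfolding vol_functor_def using nat_iso_iff[OF Fd dF] by auto
  next
    case \<alpha>: True
    note [simp] = contra_nt_simps[OF F dV dW \<alpha>] cat_simps[OF functor_cats(2)[OF F]]
      cat_simps[OF functor_cats(1)[OF F]]
      volutive_category_simps(4)[OF V] volutive_category_simps(4)[OF W]
      nt_simps(1,2)[OF eV] nt_simps(1,2)[OF eW]
    note dV' = functor_op[OF dV, unfolded op_cat_simps] and dW' =
      functor_op[OF dW, unfolded op_cat_simps]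
    \<comment> \<open>The two pastings meet triple composites with different bracketings; together
      with the unit laws these identities give them a common source and the common target
      \<open>F\<close>.\<close>
    have assocL: "op_functor (dual W) \<circ>\<^sub>F op_functor F \<circ>\<^sub>F dual V = op_functor (dual W) \<circ>\<^sub>F
      (op_functor F \<circ>\<^sub>F dual V)"
      "F \<circ>\<^sub>F op_functor (dual V) \<circ>\<^sub>F dual V = F \<circ>\<^sub>F (op_functor (dual V) \<circ>\<^sub>F dual V)"
      "op_functor (dual W) \<circ>\<^sub>F dual W \<circ>\<^sub>F F = op_functor (dual W) \<circ>\<^sub>F (dual W \<circ>\<^sub>F F)"
      using comp_functor_assoc[OF dV functor_op[OF F] dW'] comp_functor_assoc[OF dV dV' F]
        comp_functor_assoc[OF F dW dW'] by auto
    have L: "nt_between (UCat V) (UCat W) (op_functor (dual W) \<circ>\<^sub>F (op_functor F \<circ>\<^sub>F dual V)) F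
        ((id_nt F \<circ>\<^sub>H eta V) \<bullet>\<^sub>V (op_nt \<alpha> \<circ>\<^sub>H id_nt (dual V)))"
      using nt_vcomp[OF nt_hcomp[OF nt_id[OF F] eV]]
        nt_hcomp[OF nt_op[OF \<alpha>] nt_id[OF dV]]
      by (simp add: op_comp_functor comp_functor_id[OF F] assocL)
    have R: "nt_between (UCat V) (UCat W) (op_functor (dual W) \<circ>\<^sub>F (op_functor F \<circ>\<^sub>F dual V)) F
        ((eta W \<circ>\<^sub>H id_nt F) \<bullet>\<^sub>V (id_nt (op_functor (dual W)) \<circ>\<^sub>H \<alpha>))"
      using nt_vcomp[OF nt_hcomp[OF eW nt_id[OF F]]]
        nt_hcomp[OF nt_id[OF dW'] \<alpha>]
      by (simp add: comp_functor_id[OF F] assocL)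
    have eq: "(id_nt F \<circ>\<^sub>H eta V) \<bullet>\<^sub>V (op_nt \<alpha> \<circ>\<^sub>H id_nt (dual V)) =
        (eta W \<circ>\<^sub>H id_nt F) \<bullet>\<^sub>V (id_nt (op_functor (dual W)) \<circ>\<^sub>H \<alpha>) \<longleftrightarrow>
      (\<forall>a \<in> Obj (UCat V). component ((id_nt F \<circ>\<^sub>H eta V) \<bullet>\<^sub>V (op_nt \<alpha> \<circ>\<^sub>H id_nt (dual V))) a =
        component ((eta W \<circ>\<^sub>H id_nt F) \<bullet>\<^sub>V (id_nt (op_functor (dual W)) \<circ>\<^sub>H \<alpha>)) a)"
      using nt_eqI[OF L R] by metis
    show ?thesis
      unfolding vol_functor_def case_prod_conv eq nat_iso_iff[OF Fd dF]
      using V W F \<alpha> by simp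
  qed
qed

text \<open>Read in the target category rather than in its opposite, the vertical composite is
  reversed: the condition becomes \<open>\<phi> (d a) \<circ> \<alpha>1 a \<circ> d' (\<phi> a) =
  \<alpha>2 a\<close>, again tested object by object.\<close>

lemma vol_trans_iff:
  "vol_trans V W (F1, \<alpha>1) (F2, \<alpha>2) \<phi> \<longleftrightarrow> vol_functor V W (F1, \<alpha>1) \<and> vol_functor V W (F2, \<alpha>2) \<and>
     nt_between (UCat V) (UCat W) F1 F2 \<phi> \<and>
     (\<forall>a \<in> Obj (UCat V).
       Comp (UCat W) (FOb (dual W) (FOb F2 a)) (FOb F1 (FOb (dual V) a)) (FOb F2 (FOb (dual V) a))
         (component \<phi> (FOb (dual V) a))
         (Comp (UCat W) (FOb (dual W) (FOb F2 a)) (FOb (dual W) (FOb F1 a)) (FOb F1 (FOb (dual V) a))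
           (component \<alpha>1 a) (FMor (dual W) (FOb F1 a) (FOb F2 a) (component \<phi> a))) =
       component \<alpha>2 a)"
proof (cases "vol_functor V W (F1, \<alpha>1) \<and> vol_functor V W (F2, \<alpha>2) \<and>
    nt_between (UCat V) (UCat W) F1 F2 \<phi>")
  case False
  then show ?thesis
    by (auto simp: vol_trans_def vol_functor_iff nt_between_def)
next
  case True
  then have V: "volutive_category V" and W: "volutive_category W"
    and F1: "functor_between (UCat V) (UCat W) F1" and F2: "functor_between (UCat V) (UCat W) F2"
    and \<alpha>1: "nt_between (UCat V) (op_cat (UCat W)) (op_functor F1 \<circ>\<^sub>F dual V) (dual W \<circ>\<^sub>F F1) \<alpha>1"
    and \<alpha>2: "nt_between (UCat V) (op_cat (UCat W)) (op_functor F2 \<circ>\<^sub>F dual V) (dual W \<circ>\<^sub>F F2) \<alpha>2"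
    and \<phi>: "nt_between (UCat V) (UCat W) F1 F2 \<phi>"
    by (auto simp: vol_functor_iff)
  note dV = volutive_category_simps(2)[OF V] and dW = volutive_category_simps(2)[OF W]
  note [simp] = contra_simps[OF dV] contra_simps[OF dW] functor_simps[OF F1] functor_simps[OF F2]
    contra_nt_simps[OF F1 dV dW \<alpha>1] contra_nt_simps[OF F2 dV dW \<alpha>2] nt_simps[OF \<phi>]
    cat_simps[OF functor_cats(2)[OF F1]] cat_simps[OF functor_cats(1)[OF F1]]
  have L: "nt_between (UCat V) (op_cat (UCat W)) (op_functor F2 \<circ>\<^sub>F dual V) (dual W \<circ>\<^sub>F F2)
      ((id_nt (dual W) \<circ>\<^sub>H \<phi>) \<bullet>\<^sub>V \<alpha>1 \<bullet>\<^sub>V (op_nt \<phi> \<circ>\<^sub>H id_nt (dual V)))"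
    by (intro nt_vcomp[of _ _ "op_functor F1 \<circ>\<^sub>F dual V"] nt_vcomp[OF nt_hcomp[OF nt_id[OF dW] \<phi>] \<alpha>1]
        nt_hcomp[OF nt_op[OF \<phi>] nt_id[OF dV]])
  have eq: "(id_nt (dual W) \<circ>\<^sub>H \<phi>) \<bullet>\<^sub>V \<alpha>1 \<bullet>\<^sub>V (op_nt \<phi> \<circ>\<^sub>H id_nt (dual V)) = \<alpha>2 \<longleftrightarrow>
      (\<forall>a \<in> Obj (UCat V). component ((id_nt (dual W) \<circ>\<^sub>H \<phi>) \<bullet>\<^sub>V \<alpha>1 \<bullet>\<^sub>V (op_nt \<phi> \<circ>\<^sub>H id_nt (dual V))) a =
        component \<alpha>2 a)"
    using nt_eqI[OF L \<alpha>2] by auto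
  show ?thesis
    unfolding vol_trans_def case_prod_conv eq using True by (simp add: nt_between_def)
qed

lemma vol_functorD:
  assumes "vol_functor V W (F, \<alpha>)"
  shows "volutive_category V" "volutive_category W" "functor_between (UCat V) (UCat W) F"
    and "nt_between (UCat V) (op_cat (UCat W)) (op_functor F \<circ>\<^sub>F dual V) (dual W \<circ>\<^sub>F F) \<alpha>"
    and "a \<in> Obj (UCat V) \<Longrightarrow>
      iso_mor (UCat W) (FOb (dual W) (FOb F a)) (FOb F (FOb (dual V) a)) (component \<alpha> a)"
    and "a \<in> Obj (UCat V) \<Longrightarrow>
        Comp (UCat W) (FOb (dual W) (FOb F (FOb (dual V) a))) (FOb F (FOb (dual V) (FOb (dual V) a)))
          (FOb F a) (FMor F (FOb (dual V) (FOb (dual V) a)) a (component (eta V) a))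
          (component \<alpha> (FOb (dual V) a)) =
        Comp (UCat W) (FOb (dual W) (FOb F (FOb (dual V) a))) (FOb (dual W) (FOb (dual W) (FOb F a)))
          (FOb F a) (component (eta W) (FOb F a))
          (FMor (dual W) (FOb (dual W) (FOb F a)) (FOb F (FOb (dual V) a)) (component \<alpha> a))"
  using assms by (auto simp: vol_functor_iff)

lemma vol_functor_simps:
  assumes M: "vol_functor V W (F, \<alpha>)"
  shows "Dom F = UCat V" "Cod F = UCat W"
    and "a \<in> Obj (UCat V) \<Longrightarrow> FOb F a \<in> Obj (UCat W)"
    and "f \<in> Hom (UCat V) a b \<Longrightarrow> FMor F a b f \<in> Hom (UCat W) (FOb F a) (FOb F b)"
    and "a \<in> Obj (UCat V) \<Longrightarrow> FMor F a a (Idt (UCat V) a) = Idt (UCat W) (FOb F a)"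
    and "g \<in> Hom (UCat V) b c \<Longrightarrow> f \<in> Hom (UCat V) a b \<Longrightarrow> FMor F a c (Comp (UCat V) a b c g f) =
      Comp (UCat W) (FOb F a) (FOb F b) (FOb F c) (FMor F b c g) (FMor F a b f)"
    and "Src \<alpha> = op_functor F \<circ>\<^sub>F dual V" "Trg \<alpha> = dual W \<circ>\<^sub>F F"
    and "a \<in> Obj (UCat V) \<Longrightarrow>
      component \<alpha> a \<in> Hom (UCat W) (FOb (dual W) (FOb F a)) (FOb F (FOb (dual V) a))"
  using functor_simps[OF vol_functorD(3)[OF M]]
    contra_nt_simps[OF vol_functorD(3)[OF M] volutive_category_simps(2) volutive_category_simps(2)
      vol_functorD(4)[OF M]]
    vol_functorD(1,2)[OF M]
  by auto

lemma vol_functor_natural: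
  assumes M: "vol_functor V W (F, \<alpha>)" and f: "f \<in> Hom (UCat V) a b"
  shows "Comp (UCat W) (FOb (dual W) (FOb F b)) (FOb F (FOb (dual V) b)) (FOb F (FOb (dual V) a))
        (FMor F (FOb (dual V) b) (FOb (dual V) a) (FMor (dual V) a b f)) (component \<alpha> b) =
      Comp (UCat W) (FOb (dual W) (FOb F b)) (FOb (dual W) (FOb F a)) (FOb F (FOb (dual V) a))
        (component \<alpha> a) (FMor (dual W) (FOb F a) (FOb F b) (FMor F a b f))"
  using contra_nt_simps(4)[OF vol_functorD(3)[OF M] _ _ vol_functorD(4)[OF M] f]
    vol_functorD(1,2)[OF M] volutive_category_simps(2) by auto

section \<open>Identity and composition of 1-morphisms\<close>

lemma functor_iso_mor:
  assumes F: "functor_between C D F" and f: "iso_mor C a b f"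
  shows "iso_mor D (FOb F a) (FOb F b) (FMor F a b f)"
proof -
  obtain g where g: "inverse_pair C a b f g"
    using f by (auto simp: iso_mor_def)
  then have "a \<in> Obj C" "b \<in> Obj C"
    using category.Hom_Obj[OF functor_cats(1)[OF F]] by (auto simp: inverse_pair_def)
  with g have "inverse_pair D (FOb F a) (FOb F b) (FMor F a b f) (FMor F b a g)"
    by (auto simp: inverse_pair_def functor_simps[OF F] simp flip: functor_simps(6)[OF F])
  then show ?thesis
    by (auto simp: iso_mor_def)
qed

text \<open>Functors preserve identities, so for the identity functor with identity \<alpha> both
  sides of the law at \<open>a\<close> collapse to \<open>\<eta> a\<close>.\<close>

lemma vol_functor_id:
  assumes V: "volutive_category V"
  shows "vol_functor V V (vol_id V)"
proof -
  note d = volutive_category_simps(2)[OF V] and C = volutive_category_simps(1)[OF V]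
  note [simp] = contra_simps[OF d] cat_simps[OF C] volutive_category_simps(4)[OF V]
    comp_functor_id[OF d]
    op_id_functor
  show ?thesis
    unfolding vol_id_def vol_functor_iff
    using V C nt_id[OF d] by (auto simp: functor_id iso_mor_Idt)
qed

text \<open>The pasting is composed in the opposite category, so in the target category \<beta> acts
  first: the component is \<open>G (\<alpha> a) \<circ> \<beta> (F a)\<close>.\<close>

lemma vol_comp_component:
  assumes M: "vol_functor U V (F, \<alpha>)" and N: "vol_functor V W (G, \<beta>)" and a: "a \<in> Obj (UCat U)"
  shows "component (snd (vol_comp (G, \<beta>) (F, \<alpha>))) a =
    Comp (UCat W) (FOb (dual W) (FOb G (FOb F a))) (FOb G (FOb (dual V) (FOb F a)))
      (FOb G (FOb F (FOb (dual U) a)))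
      (FMor G (FOb (dual V) (FOb F a)) (FOb F (FOb (dual U) a)) (component \<alpha> a))
      (component \<beta> (FOb F a))"
proof -
  note dU = volutive_category_simps(2)[OF vol_functorD(1)[OF M]]
    and dV = volutive_category_simps(2)[OF vol_functorD(2)[OF M]]
    and dW = volutive_category_simps(2)[OF vol_functorD(2)[OF N]]
  note [simp] = contra_simps[OF dU] contra_simps[OF dV] contra_simps[OF dW] vol_functor_simps[OF M]
    vol_functor_simps[OF N] cat_simps[OF volutive_category_simps(1)[OF vol_functorD(2)[OF N]]]
    cat_simps[OF volutive_category_simps(1)[OF vol_functorD(2)[OF M]]]
  show ?thesis
    using a by (simp add: vol_comp_def)
qed

lemma nt_vol_comp:
  assumes M: "vol_functor U V (F, \<alpha>)" and N: "vol_functor V W (G, \<beta>)"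
  shows "nt_between (UCat U) (op_cat (UCat W)) (op_functor (G \<circ>\<^sub>F F) \<circ>\<^sub>F dual U) (dual W \<circ>\<^sub>F (G \<circ>\<^sub>F F))
    (snd (vol_comp (G, \<beta>) (F, \<alpha>)))"
proof -
  note dU = volutive_category_simps(2)[OF vol_functorD(1)[OF M]]
    and dV = volutive_category_simps(2)[OF vol_functorD(2)[OF M]]
    and dW = volutive_category_simps(2)[OF vol_functorD(2)[OF N]]
    and F = vol_functorD(3)[OF M] and G = vol_functorD(3)[OF N]
    and \<alpha> = vol_functorD(4)[OF M] and \<beta> = vol_functorD(4)[OF N]
  show ?thesis
    unfolding vol_comp_def case_prod_conv snd_conv op_comp_functor
    using nt_vcomp[OF nt_hcomp[OF \<beta> nt_id[OF F]]] nt_hcomp[OF nt_id[OF functor_op[OF G]] \<alpha>]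
    by (simp add: comp_functor_assoc[OF dU functor_op[OF F] functor_op[OF G]]
      comp_functor_assoc[OF F dV functor_op[OF G]] comp_functor_assoc[OF F G dW])
qed

text \<open>Three moves turn \<open>G (F (\<eta> a)) \<circ> \<gamma> (d a)\<close> into
  \<open>\<eta>'' (G (F a)) \<circ> d'' (\<gamma> a)\<close>: the law for \<open>F\<close> under
  \<open>G\<close>, naturality of \<beta> at the component of \<alpha>, and the law for
  \<open>G\<close> at \<open>F a\<close>. Invertibility passes to \<gamma> because functors preserve
  isomorphisms and these compose.\<close>

lemma vol_functor_comp:
  assumes M: "vol_functor U V M" and N: "vol_functor V W N"
  shows "vol_functor U W (vol_comp N M)"
proof -
  obtain F \<alpha> G \<beta> where MN: "M = (F, \<alpha>)" "N = (G, \<beta>)"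
    by (cases M; cases N)
  note M = M[unfolded MN] and N = N[unfolded MN]
  define \<gamma> where "\<gamma> = snd (vol_comp (G, \<beta>) (F, \<alpha>))"
  note U = vol_functorD(1)[OF M] and V = vol_functorD(2)[OF M] and W = vol_functorD(2)[OF N]
  note dU = volutive_category_simps(2)[OF U] and dV = volutive_category_simps(2)[OF V]
    and dW = volutive_category_simps(2)[OF W] and CV = volutive_category_simps(1)[OF V]
    and CW = volutive_category_simps(1)[OF W] and F = vol_functorD(3)[OF M] and G =
      vol_functorD(3)[OF N]
  note [simp] = contra_simps[OF dU] contra_simps[OF dV] contra_simps[OF dW] vol_functor_simps[OF M]
    vol_functor_simps[OF N] cat_simps[OF CW] cat_simps[OF CV]
    volutive_category_simps(4)[OF U] volutive_category_simps(4)[OF V] volutive_category_simps(4)[OF W]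
    vol_comp_component[OF M N, folded \<gamma>_def]
  have "vol_functor U W (G \<circ>\<^sub>F F, \<gamma>)"
    unfolding vol_functor_iff
  proof (intro conjI ballI)
    show "volutive_category U" "volutive_category W" by fact+
    show "functor_between (UCat U) (UCat W) (G \<circ>\<^sub>F F)"
      by (rule functor_comp[OF F G])
    show "nt_between (UCat U) (op_cat (UCat W)) (op_functor (G \<circ>\<^sub>F F) \<circ>\<^sub>F dual U) (dual W \<circ>\<^sub>F (G \<circ>\<^sub>F F)) \<gamma>"
      unfolding \<gamma>_def by (rule nt_vol_comp[OF M N])
    fix a assume a: "a \<in> Obj (UCat U)"
    show "iso_mor (UCat W) (FOb (dual W) (FOb (G \<circ>\<^sub>F F) a)) (FOb (G \<circ>\<^sub>F F) (FOb (dual U) a))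
      (component \<gamma> a)"
      using a by (simp add: iso_mor_Comp[OF CW] functor_iso_mor[OF G] vol_functorD(5)[OF M]
        vol_functorD(5)[OF N])
    let ?F = "FOb F" and ?G = "FOb G" and ?d = "FOb (dual U)" and ?d' = "FOb (dual V)"
      and ?d'' = "FOb (dual W)" and ?C = "Comp (UCat W)"
    \<comment> \<open>The law of \<open>(F, \<alpha>)\<close> at \<open>a\<close>, mapped by
      \<open>G\<close>.\<close>
    have 1: "?C (?G (?d' (?F (?d a)))) (?G (?F (?d (?d a)))) (?G (?F a))
          (FMor G (?F (?d (?d a))) (?F a) (FMor F (?d (?d a)) a (component (eta U) a)))
          (FMor G (?d' (?F (?d a))) (?F (?d (?d a))) (component \<alpha> (?d a))) =
        ?C (?G (?d' (?F (?d a)))) (?G (?d' (?d' (?F a)))) (?G (?F a))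
          (FMor G (?d' (?d' (?F a))) (?F a) (component (eta V) (?F a)))
          (FMor G (?d' (?F (?d a))) (?d' (?d' (?F a)))
            (FMor (dual V) (?d' (?F a)) (?F (?d a)) (component \<alpha> a)))"
      using a arg_cong[OF vol_functorD(6)[OF M a], of "FMor G (?d' (?F (?d a))) (?F a)"] by simp
    \<comment> \<open>After composition with \<open>\<beta> (F (d a))\<close> on the right,
      naturality of \<beta> at \<open>\<alpha> a\<close> moves \<open>G (\<alpha> a)\<close> under
      \<open>d''\<close>.\<close>
    have 2: "?C (?d'' (?G (?F (?d a)))) (?G (?d' (?F (?d a)))) (?G (?F a))
          (?C (?G (?d' (?F (?d a)))) (?G (?F (?d (?d a)))) (?G (?F a))
            (FMor G (?F (?d (?d a))) (?F a) (FMor F (?d (?d a)) a (component (eta U) a)))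
            (FMor G (?d' (?F (?d a))) (?F (?d (?d a))) (component \<alpha> (?d a))))
          (component \<beta> (?F (?d a))) =
        ?C (?d'' (?G (?F (?d a)))) (?d'' (?G (?d' (?F a)))) (?G (?F a))
          (?C (?d'' (?G (?d' (?F a)))) (?G (?d' (?d' (?F a)))) (?G (?F a))
            (FMor G (?d' (?d' (?F a))) (?F a) (component (eta V) (?F a)))
            (component \<beta> (?d' (?F a))))
          (FMor (dual W) (?G (?d' (?F a))) (?G (?F (?d a)))
             (FMor G (?d' (?F a)) (?F (?d a)) (component \<alpha> a)))"
      unfolding 1 using a by (simp add: vol_functor_natural[OF N])
    show "?C (?d'' (FOb (G \<circ>\<^sub>F F) (?d a))) (FOb (G \<circ>\<^sub>F F) (?d (?d a))) (FOb (G \<circ>\<^sub>F F) a)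
        (FMor (G \<circ>\<^sub>F F) (?d (?d a)) a (component (eta U) a)) (component \<gamma> (?d a)) =
      ?C (?d'' (FOb (G \<circ>\<^sub>F F) (?d a))) (?d'' (?d'' (FOb (G \<circ>\<^sub>F F) a))) (FOb (G \<circ>\<^sub>F F) a)
        (component (eta W) (FOb (G \<circ>\<^sub>F F) a))
        (FMor (dual W) (?d'' (FOb (G \<circ>\<^sub>F F) a)) (FOb (G \<circ>\<^sub>F F) (?d a)) (component \<gamma> a))"
      \<comment> \<open>The law of \<open>(G, \<beta>)\<close> at \<open>F a\<close> produces
        \<open>d'' (\<beta> (F a))\<close>, which contravariance of \<open>d''\<close> merges with
        \<open>d'' (G (\<alpha> a))\<close> into \<open>d'' (\<gamma> a)\<close>.\<close>
      using a 2[unfolded vol_functorD(6)[OF N vol_functor_simps(3)[OF M a]]] by simp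
  qed
  then show ?thesis
    by (simp add: MN \<gamma>_def vol_comp_def)
qed

section \<open>2-morphisms and their composites\<close>

lemma vol_transD:
  assumes "vol_trans V W M N \<phi>"
  shows "vol_functor V W M" "vol_functor V W N" "nt_between (UCat V) (UCat W) (fst M) (fst N) \<phi>"
  using assms by (cases M; cases N; simp add: vol_trans_iff)+

lemma vol_trans_id:
  assumes M: "vol_functor V W M"
  shows "vol_trans V W M M (id_nt (fst M))"
proof -
  obtain F \<alpha> where [simp]: "M = (F, \<alpha>)"
    by (cases M)
  note M' = M[simplified]
  note V = vol_functorD(1)[OF M'] and W = vol_functorD(2)[OF M']
  note [simp] = contra_simps[OF volutive_category_simps(2)[OF V]] vol_functor_simps[OF M']
    contra_simps[OF volutive_category_simps(2)[OF W]] cat_simps[OF volutive_category_simps(1)[OF W]]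
  show ?thesis
    using M nt_id[OF vol_functorD(3)[OF M']] by (simp add: vol_trans_iff)
qed

lemma vol_trans_vcomp:
  assumes \<psi>: "vol_trans V W M N \<psi>" and \<phi>: "vol_trans V W L M \<phi>"
  shows "vol_trans V W L N (\<psi> \<bullet>\<^sub>V \<phi>)"
proof -
  obtain F \<alpha> G \<beta> H \<gamma> where [simp]: "L = (F, \<alpha>)" "M = (G, \<beta>)" "N = (H, \<gamma>)"
    by (cases L; cases M; cases N)
  note L = vol_transD(1)[OF \<phi>, simplified] and M = vol_transD(2)[OF \<phi>, simplified]
    and N = vol_transD(2)[OF \<psi>, simplified]
  note \<phi>' = vol_transD(3)[OF \<phi>, simplified] and \<psi>' = vol_transD(3)[OF \<psi>, simplified]
  note V = vol_functorD(1)[OF L] and W = vol_functorD(2)[OF L]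
  note [simp] = contra_simps[OF volutive_category_simps(2)[OF V]]
    vol_functor_simps[OF L] vol_functor_simps[OF M] vol_functor_simps[OF N]
    contra_simps[OF volutive_category_simps(2)[OF W]] cat_simps[OF volutive_category_simps(1)[OF W]]
    nt_simps[OF \<phi>'] nt_simps[OF \<psi>']
  let ?d = "FOb (dual V)" and ?d' = "FOb (dual W)" and ?C = "Comp (UCat W)"
  have *: "?C (?d' (FOb H a)) (FOb F (?d a)) (FOb H (?d a)) (component (\<psi> \<bullet>\<^sub>V \<phi>) (?d a))
      (?C (?d' (FOb H a)) (?d' (FOb F a)) (FOb F (?d a)) (component \<alpha> a)
        (FMor (dual W) (FOb F a) (FOb H a) (component (\<psi> \<bullet>\<^sub>V \<phi>) a))) = component \<gamma> a"
    if a: "a \<in> Obj (UCat V)" for a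
  proof -
    have 1: "?C (?d' (FOb G a)) (FOb F (?d a)) (FOb G (?d a)) (component \<phi> (?d a))
         (?C (?d' (FOb G a)) (?d' (FOb F a)) (FOb F (?d a))
           (component \<alpha> a) (FMor (dual W) (FOb F a) (FOb G a) (component \<phi> a))) = component \<beta> a"
      using \<phi> a by (simp add: vol_trans_iff)
    have 2: "?C (?d' (FOb H a)) (FOb G (?d a)) (FOb H (?d a)) (component \<psi> (?d a))
         (?C (?d' (FOb H a)) (?d' (FOb G a)) (FOb G (?d a))
           (component \<beta> a) (FMor (dual W) (FOb G a) (FOb H a) (component \<psi> a))) = component \<gamma> a"
      using \<psi> a by (simp add: vol_trans_iff)
    \<comment> \<open>The condition on \<phi> replaces \<open>\<beta> a\<close> inside the condition
      on \<psi>; contravariance of \<open>d'\<close> then merges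
      \<open>d' (\<phi> a) \<circ> d' (\<psi> a)\<close> into \<open>d'\<close> of the
      composite.\<close>
    show ?thesis
      using a 2[folded 1] by simp
  qed
  show ?thesis
    using \<psi> \<phi> nt_vcomp[OF \<psi>' \<phi>'] * by (simp add: vol_trans_iff)
qed

text \<open>The component of \<open>\<psi> \<circ>\<^sub>H \<phi>\<close> at \<open>a\<close> is
  \<open>\<psi> (F' a) \<circ> G (\<phi> a)\<close>. The conditions on \<psi> and \<phi> are joined
  by two naturality squares, that of \<psi> at \<open>\<alpha>' a\<close> and that of \<beta> at
  \<open>\<phi> a\<close>.\<close>

lemma vol_trans_hcomp:
  assumes \<psi>: "vol_trans V W N N' \<psi>" and \<phi>: "vol_trans U V M M' \<phi>"
  shows "vol_trans U W (vol_comp N M) (vol_comp N' M') (\<psi> \<circ>\<^sub>H \<phi>)"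
proof -
  obtain F \<alpha> F' \<alpha>' G \<beta> G' \<beta>' where [simp]: "M = (F, \<alpha>)" "M' = (F', \<alpha>')" "N = (G, \<beta>)" "N' = (G', \<beta>')"
    by (cases M; cases M'; cases N; cases N')
  note M = vol_transD(1)[OF \<phi>, simplified] and M' = vol_transD(2)[OF \<phi>, simplified]
    and N = vol_transD(1)[OF \<psi>, simplified] and N' = vol_transD(2)[OF \<psi>, simplified]
  note \<phi>' = vol_transD(3)[OF \<phi>, simplified] and \<psi>' = vol_transD(3)[OF \<psi>, simplified]
  note U = vol_functorD(1)[OF M] and V = vol_functorD(2)[OF M] and W = vol_functorD(2)[OF N]
  note [simp] = contra_simps[OF volutive_category_simps(2)[OF U]]
    contra_simps[OF volutive_category_simps(2)[OF V]]
    vol_functor_simps[OF M] vol_functor_simps[OF M'] vol_functor_simps[OF N] vol_functor_simps[OF N']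
    contra_simps[OF volutive_category_simps(2)[OF W]] cat_simps[OF volutive_category_simps(1)[OF W]]
    cat_simps[OF volutive_category_simps(1)[OF V]]
    nt_simps[OF \<phi>'] nt_simps[OF \<psi>']
  define \<gamma> where "\<gamma> = snd (vol_comp N M)"
  define \<gamma>' where "\<gamma>' = snd (vol_comp N' M')"
  have eqs: "vol_comp N M = (G \<circ>\<^sub>F F, \<gamma>)" "vol_comp N' M' = (G' \<circ>\<^sub>F F', \<gamma>')"
    by (simp_all add: vol_comp_def \<gamma>_def \<gamma>'_def)
  note [simp] = vol_comp_component[OF M N, unfolded eqs[simplified] snd_conv]
    vol_comp_component[OF M' N', unfolded eqs[simplified] snd_conv]
  let ?d = "FOb (dual U)" and ?d' = "FOb (dual V)" and ?d'' = "FOb (dual W)" and ?C = "Comp (UCat W)"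
  let ?F = "FOb F" and ?F' = "FOb F'" and ?G = "FOb G" and ?G' = "FOb G'"
  have *: "?C (?d'' (?G' (?F' a))) (?G (?F (?d a))) (?G' (?F' (?d a))) (component (\<psi> \<circ>\<^sub>H \<phi>) (?d a))
      (?C (?d'' (?G' (?F' a))) (?d'' (?G (?F a))) (?G (?F (?d a))) (component \<gamma> a)
        (FMor (dual W) (?G (?F a)) (?G' (?F' a)) (component (\<psi> \<circ>\<^sub>H \<phi>) a))) = component \<gamma>' a"
    if a: "a \<in> Obj (UCat U)" for a
  proof -
    have 1: "Comp (UCat V) (?d' (?F' a)) (?F (?d a)) (?F' (?d a)) (component \<phi> (?d a))
         (Comp (UCat V) (?d' (?F' a)) (?d' (?F a)) (?F (?d a))
           (component \<alpha> a) (FMor (dual V) (?F a) (?F' a) (component \<phi> a))) = component \<alpha>' a"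
      using \<phi> a by (simp add: vol_trans_iff)
    have 2: "?C (?d'' (?G' (?F' a))) (?G (?d' (?F' a))) (?G' (?d' (?F' a))) (component \<psi> (?d' (?F' a)))
         (?C (?d'' (?G' (?F' a))) (?d'' (?G (?F' a))) (?G (?d' (?F' a)))
           (component \<beta> (?F' a)) (FMor (dual W) (?G (?F' a)) (?G' (?F' a)) (component \<psi> (?F' a)))) =
         component \<beta>' (?F' a)"
      using \<psi> a by (simp add: vol_trans_iff)
    have nat: "?C (?d'' (?G (?F' a))) (?d'' (?G (?F a))) (?G (?d' (?F a))) (component \<beta> (?F a))
        (FMor (dual W) (?G (?F a)) (?G (?F' a)) (FMor G (?F a) (?F' a) (component \<phi> a))) =
      ?C (?d'' (?G (?F' a))) (?G (?d' (?F' a))) (?G (?d' (?F a)))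
        (FMor G (?d' (?F' a)) (?d' (?F a)) (FMor (dual V) (?F a) (?F' a) (component \<phi> a)))
        (component \<beta> (?F' a))"
      using vol_functor_natural[OF N nt_simps(3)[OF \<phi>' a]] by simp
    \<comment> \<open>\<open>nat\<close> with \<open>d'' (\<psi> (F' a))\<close> composed on the
      right, the shape in which it occurs in the full composite.\<close>
    have nat': "?C (?d'' (?G' (?F' a))) (?d'' (?G (?F a))) (?G (?d' (?F a))) (component \<beta> (?F a))
        (?C (?d'' (?G' (?F' a))) (?d'' (?G (?F' a))) (?d'' (?G (?F a)))
          (FMor (dual W) (?G (?F a)) (?G (?F' a)) (FMor G (?F a) (?F' a) (component \<phi> a))) 
          (FMor (dual W) (?G (?F' a)) (?G' (?F' a)) (component \<psi> (?F' a)))) =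
      ?C (?d'' (?G' (?F' a))) (?G (?d' (?F' a))) (?G (?d' (?F a)))
        (FMor G (?d' (?F' a)) (?d' (?F a)) (FMor (dual V) (?F a) (?F' a) (component \<phi> a)))
        (?C (?d'' (?G' (?F' a))) (?d'' (?G (?F' a))) (?G (?d' (?F' a))) (component \<beta> (?F' a))
          (FMor (dual W) (?G (?F' a)) (?G' (?F' a)) (component \<psi> (?F' a))))"
      using a arg_cong[OF nat, of "\<lambda>x. ?C (?d'' (?G' (?F' a))) (?d'' (?G (?F' a))) (?G (?d' (?F a))) x
        (FMor (dual W) (?G (?F' a)) (?G' (?F' a)) (component \<psi> (?F' a)))"] by simp
    have "component \<gamma>' a = ?C (?d'' (?G' (?F' a))) (?G' (?d' (?F' a))) (?G' (?F' (?d a)))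
        (FMor G' (?d' (?F' a)) (?F' (?d a)) (component \<alpha>' a))
        (?C (?d'' (?G' (?F' a))) (?G (?d' (?F' a))) (?G' (?d' (?F' a))) (component \<psi> (?d' (?F' a)))
         (?C (?d'' (?G' (?F' a))) (?d'' (?G (?F' a))) (?G (?d' (?F' a)))
           (component \<beta> (?F' a)) (FMor (dual W) (?G (?F' a)) (?G' (?F' a)) (component \<psi> (?F' a)))))"
      using a by (simp add: 2)
    \<comment> \<open>Naturality of \<psi> at \<open>\<alpha>' a\<close> moves \<psi> to the
      outside; what remains is rewritten by the condition on \<phi> and by
      \<open>nat'\<close>.\<close>
    also have "\<dots> = ?C (?d'' (?G' (?F' a))) (?G (?F' (?d a))) (?G' (?F' (?d a)))
      (component \<psi> (?F' (?d a)))
        (?C (?d'' (?G' (?F' a))) (?G (?d' (?F' a))) (?G (?F' (?d a)))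
         (FMor G (?d' (?F' a)) (?F' (?d a)) (component \<alpha>' a))
         (?C (?d'' (?G' (?F' a))) (?d'' (?G (?F' a))) (?G (?d' (?F' a)))
           (component \<beta> (?F' a)) (FMor (dual W) (?G (?F' a)) (?G' (?F' a)) (component \<psi> (?F' a)))))"
      using a by (simp add: nt_natural_comp[OF \<psi>'])
    finally show ?thesis
      using a by (simp add: nat' flip: 1)
  qed
  show ?thesis
    using vol_functor_comp[OF M N] vol_functor_comp[OF M' N'] nt_hcomp[OF \<psi>' \<phi>'] *
    unfolding eqs by (simp add: vol_trans_iff eqs[simplified])
qed

section \<open>Hom-categories and the 2-category axioms\<close>

lemma vol_HomCat_simps [simp]:
  "M \<in> Obj (vol_HomCat V W) \<longleftrightarrow> vol_functor V W M"
  "\<phi> \<in> Hom (vol_HomCat V W) M N \<longleftrightarrow> vol_trans V W M N \<phi>"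
  "vol_functor V W M \<Longrightarrow> Idt (vol_HomCat V W) M = id_nt (fst M)"
  "vol_trans V W M N \<psi> \<Longrightarrow> vol_trans V W L M \<phi> \<Longrightarrow> Comp (vol_HomCat V W) L M N \<psi> \<phi> = \<psi> \<bullet>\<^sub>V \<phi>"
  by (simp_all add: vol_HomCat_def)

lemma category_vol_HomCat: "category (vol_HomCat V W)"
proof
  show "Comp (vol_HomCat V W) a b d (Comp (vol_HomCat V W) b c d h g) f =
      Comp (vol_HomCat V W) a c d h (Comp (vol_HomCat V W) a b c g f)"
    if "h \<in> Hom (vol_HomCat V W) c d" "g \<in> Hom (vol_HomCat V W) b c" "f \<in> Hom (vol_HomCat V W) a b"
    for a b c d h g f
    using that by (simp add: vol_trans_vcomp vcomp_assoc[OF vol_transD(3) vol_transD(3) vol_transD(3)])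
  show "Idt (vol_HomCat V W) a = undefined" if "a \<notin> Obj (vol_HomCat V W)" for a
    using that by (simp add: vol_HomCat_def)
  show "Comp (vol_HomCat V W) a b c g f = undefined"
    if "\<not> (g \<in> Hom (vol_HomCat V W) b c \<and> f \<in> Hom (vol_HomCat V W) a b)" for a b c g f
    using that by (auto simp: vol_HomCat_def)
  show "Comp (vol_HomCat V W) a a b f (Idt (vol_HomCat V W) a) = f"
    "Comp (vol_HomCat V W) a b b (Idt (vol_HomCat V W) b) f = f"
    if "f \<in> Hom (vol_HomCat V W) a b" for a b f
    using that vol_transD(1,2)[of V W a b f]
    by (simp_all add: vol_trans_id vcomp_id[OF vol_transD(3)])
qed (auto intro: vol_trans_id vol_trans_vcomp dest: vol_transD)

text \<open>Both bracketings have the component \<open>H (G (\<alpha> a)) \<circ> H (\<beta> (F a))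
  \<circ> \<gamma> (G (F a))\<close>; they differ only in whether \<open>H\<close> is applied before
  or after the first two factors are composed.\<close>

lemma vol_comp_assoc:
  assumes L: "vol_functor U V L" and M: "vol_functor V W M" and N: "vol_functor W X N"
  shows "vol_comp (vol_comp N M) L = vol_comp N (vol_comp M L)"
proof -
  obtain F \<alpha> G \<beta> H \<gamma> where eqs [simp]: "L = (F, \<alpha>)" "M = (G, \<beta>)" "N = (H, \<gamma>)"
    by (cases L; cases M; cases N)
  note L = L[simplified] and M = M[simplified] and N = N[simplified]
  note F = vol_functorD(3)[OF L] and G = vol_functorD(3)[OF M] and H = vol_functorD(3)[OF N]
  obtain \<delta> \<epsilon> where \<delta>: "vol_comp (G, \<beta>) (F, \<alpha>) = (G \<circ>\<^sub>F F, \<delta>)" and \<epsilon>: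
    "vol_comp (H, \<gamma>) (G, \<beta>) = (H \<circ>\<^sub>F G, \<epsilon>)"
    by (simp add: vol_comp_def)
  note GF = vol_functor_comp[OF L M, unfolded \<delta>] and HG = vol_functor_comp[OF M N, unfolded \<epsilon>]
  note dU = volutive_category_simps(2)[OF vol_functorD(1)[OF L]]
    and dV = volutive_category_simps(2)[OF vol_functorD(2)[OF L]]
    and dW = volutive_category_simps(2)[OF vol_functorD(2)[OF M]]
    and dX = volutive_category_simps(2)[OF vol_functorD(2)[OF N]]
  note [simp] = contra_simps[OF dU] contra_simps[OF dV] contra_simps[OF dW] contra_simps[OF dX]
    vol_functor_simps[OF L] vol_functor_simps[OF M] vol_functor_simps[OF N]
    cat_simps[OF volutive_category_simps(1)[OF vol_functorD(2)[OF N]]]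
    cat_simps[OF volutive_category_simps(1)[OF vol_functorD(2)[OF M]]]
  have "snd (vol_comp (H \<circ>\<^sub>F G, \<epsilon>) (F, \<alpha>)) = snd (vol_comp (H, \<gamma>) (G \<circ>\<^sub>F F, \<delta>))"
  proof (rule nt_eqI[OF nt_vol_comp[OF L HG] nt_vol_comp[OF GF N, folded comp_functor_assoc[OF F G H]]])
    fix a assume "a \<in> Obj (UCat U)"
    then show "component (snd (vol_comp (H \<circ>\<^sub>F G, \<epsilon>) (F, \<alpha>))) a =
        component (snd (vol_comp (H, \<gamma>) (G \<circ>\<^sub>F F, \<delta>))) a"
      using vol_comp_component[OF L M, unfolded \<delta>] vol_comp_component[OF M N, unfolded \<epsilon>]
      by (simp add: vol_comp_component[OF L HG] vol_comp_component[OF GF N])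
  qed
  moreover have "fst (vol_comp (H \<circ>\<^sub>F G, \<epsilon>) (F, \<alpha>)) = fst (vol_comp (H, \<gamma>) (G \<circ>\<^sub>F F, \<delta>))"
    by (simp add: vol_comp_def comp_functor_assoc[OF F G H])
  ultimately show ?thesis
    unfolding eqs \<delta> \<epsilon> by (rule prod_eqI[rotated])
qed

text \<open>Whiskering with an identity functor changes nothing and the other half of the pasting is
  an identity transformation, so the unit laws for transformations give the result without passing
  to components.\<close>

lemma vol_comp_id:
  assumes M: "vol_functor V W M"
  shows "vol_comp M (vol_id V) = M" "vol_comp (vol_id W) M = M"
proof -
  obtain F \<alpha> where eqs [simp]: "M = (F, \<alpha>)"
    by (cases M)
  note M = M[simplified]
  note F = vol_functorD(3)[OF M] and \<alpha> = vol_functorD(4)[OF M]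
  note dV = volutive_category_simps(2)[OF vol_functorD(1)[OF M]]
    and dW = volutive_category_simps(2)[OF vol_functorD(2)[OF M]]
  show "vol_comp M (vol_id V) = M"
    using vcomp_id(1)[OF \<alpha>] by (simp add: vol_comp_def vol_id_def comp_functor_id[OF F] hcomp_id[OF \<alpha>]
        id_nt_hcomp[OF dV functor_op[OF F]])
  show "vol_comp (vol_id W) M = M"
    using vcomp_id(2)[OF \<alpha>] by (simp add: vol_comp_def vol_id_def comp_functor_id[OF F] hcomp_id[OF \<alpha>]
        id_nt_hcomp[OF F dW] op_id_functor)
qed

lemma Cat_O1_vol_simps [simp]:
  "Obj2 Cat_O1_vol = {V. volutive_category V}"
  "HomCat Cat_O1_vol = vol_HomCat"
  "Unit1 Cat_O1_vol = vol_id"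
  "vol_functor V W N \<Longrightarrow> vol_functor U V M \<Longrightarrow> FOb (HComp Cat_O1_vol U V W) (N, M) = vol_comp N M"
  "vol_trans V W N N' \<psi> \<Longrightarrow> vol_trans U V M M' \<phi> \<Longrightarrow>
    FMor (HComp Cat_O1_vol U V W) (N, M) (N', M') (\<psi>, \<phi>) = \<psi> \<circ>\<^sub>H \<phi>"
  by (simp_all add: Cat_O1_vol_def Let_def)

lemma fst_vol_comp [simp]: "fst (vol_comp N M) = fst N \<circ>\<^sub>F fst M"
  by (simp add: vol_comp_def split: prod.split)

text \<open>Preservation of composites by horizontal composition is the interchange law;
  preservation of identities is \<open>id_nt_hcomp\<close>.\<close>

lemma functor_HComp:
  "functor_between (prod_cat (vol_HomCat V W) (vol_HomCat U V)) (vol_HomCat U W)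
    (HComp Cat_O1_vol U V W)"
    (is "functor_between ?P _ ?H")
proof (rule functor_betweenI)
  show "category ?P" "category (vol_HomCat U W)"
    by (simp_all add: category_prod category_vol_HomCat)
  show "Dom ?H = ?P" "Cod ?H = vol_HomCat U W"
    by (simp_all add: Cat_O1_vol_def Let_def)
  \<comment> \<open>Only the restriction is unfolded: membership in the product category has to keep
    the form of the assumption.\<close>
  show "FOb ?H p = undefined" if "p \<notin> Obj ?P" for p
    unfolding Cat_O1_vol_def Let_def pre2category.simps prefunctor.simps by
      (simp only: restrict_def that if_False)
  show "FMor ?H p q x = undefined" if "x \<notin> Hom ?P p q" for p q x
    unfolding Cat_O1_vol_def Let_def pre2category.simps prefunctor.simps by
      (simp only: restrict_def that if_False)
  show "FOb ?H p \<in> Obj (vol_HomCat U W)" if "p \<in> Obj ?P" for p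
    using that by (auto intro: vol_functor_comp)
  show "FMor ?H p q x \<in> Hom (vol_HomCat U W) (FOb ?H p) (FOb ?H q)"
    if "p \<in> Obj ?P" "q \<in> Obj ?P" "x \<in> Hom ?P p q" for p q x
    using that by (cases p; cases q; cases x) (auto intro: vol_trans_hcomp)
  show "FMor ?H p p (Idt ?P p) = Idt (vol_HomCat U W) (FOb ?H p)" if "p \<in> Obj ?P" for p
  proof -
    obtain G \<beta> F \<alpha> where p: "p = ((G, \<beta>), (F, \<alpha>))"
      by (metis surj_pair)
    then have M: "vol_functor U V (F, \<alpha>)" and N: "vol_functor V W (G, \<beta>)"
      using that by auto
    show ?thesis
      using vol_trans_id[OF M] vol_trans_id[OF N] M N
      by (simp add: p vol_functor_comp id_nt_hcomp[OF vol_functorD(3)[OF M] vol_functorD(3)[OF N]])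
  qed
  show "FMor ?H p r (Comp ?P p q r y x) =
      Comp (vol_HomCat U W) (FOb ?H p) (FOb ?H q) (FOb ?H r) (FMor ?H q r y) (FMor ?H p q x)"
    if "p \<in> Obj ?P" "q \<in> Obj ?P" "r \<in> Obj ?P" "y \<in> Hom ?P q r" "x \<in> Hom ?P p q" for p q r x y
    using that by (cases p; cases q; cases r; cases x; cases y)
      (auto simp: vol_trans_vcomp vol_trans_hcomp
        intro!: interchange[OF vol_transD(3) vol_transD(3) vol_transD(3) vol_transD(3)])
qed

lemma strict_2category_Cat_O1_vol: "strict_2category Cat_O1_vol"
proof (rule strict_2category.intro)
  fix A B C D :: "('o, 'm) volutive"
  show "FMor (HComp Cat_O1_vol A B D) (FOb (HComp Cat_O1_vol B C D) (h, g), f)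
    (FOb (HComp Cat_O1_vol B C D) (h', g'), f')
         (FMor (HComp Cat_O1_vol B C D) (h, g) (h', g') (z, y), x) =
       FMor (HComp Cat_O1_vol A C D) (h, FOb (HComp Cat_O1_vol A B C) (g, f))
         (h', FOb (HComp Cat_O1_vol A B C) (g', f'))
         (z, FMor (HComp Cat_O1_vol A B C) (g, f) (g', f') (y, x))"
    if "x \<in> Hom (HomCat Cat_O1_vol A B) f f'" "y \<in> Hom (HomCat Cat_O1_vol B C) g g'"
      "z \<in> Hom (HomCat Cat_O1_vol C D) h h'" for x f f' y g g' z h h'
  proof -
    have *: "vol_functor A B f" "vol_functor A B f'" "vol_functor B C g" "vol_functor B C g'"
      "vol_functor C D h" "vol_functor C D h'"
      using that by (auto dest: vol_transD)
    with that show ?thesis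
      by (simp add: vol_trans_hcomp hcomp_assoc[OF vol_transD(3) vol_transD(3) vol_transD(3)])
  qed
  show "FMor (HComp Cat_O1_vol A A B) (f, Unit1 Cat_O1_vol A) (f', Unit1 Cat_O1_vol A)
         (x, Idt (HomCat Cat_O1_vol A A) (Unit1 Cat_O1_vol A)) = x \<and>
       FMor (HComp Cat_O1_vol A B B) (Unit1 Cat_O1_vol B, f) (Unit1 Cat_O1_vol B, f')
         (Idt (HomCat Cat_O1_vol B B) (Unit1 Cat_O1_vol B), x) = x"
    if "A \<in> Obj2 Cat_O1_vol" "B \<in> Obj2 Cat_O1_vol" "x \<in> Hom (HomCat Cat_O1_vol A B) f f'" for x f f'
  proof -
    have "vol_trans A A (vol_id A) (vol_id A) (id_nt (fst (vol_id A)))"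
      "vol_trans B B (vol_id B) (vol_id B) (id_nt (fst (vol_id B)))"
      using that by (auto intro: vol_trans_id vol_functor_id)
    with that show ?thesis
      using hcomp_id[OF vol_transD(3), of A B f f' x] by (simp add: vol_functor_id)
        (simp add: vol_id_def)
  qed
qed (simp_all add: category_vol_HomCat vol_functor_id functor_HComp vol_functor_comp vol_comp_assoc
    vol_comp_id)

section \<open>Idempotent completion\<close>

text \<open>Associativity carries a relation between two morphisms past a further morphism
  \<open>k\<close>. This serves for absorbing idempotents and for cancelling inverses inside longer
  composites.\<close>

lemma comp_absorb:
  assumes "category C" "Comp C a b c g f = h" "g \<in> Hom C b c" "f \<in> Hom C a b" "k \<in> Hom C z a"
  shows "Comp C z b c g (Comp C z a b f k) = Comp C z a c h k"
  using assms by (simp flip: cat_simps(5))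

section \<open>The completed category\<close>

context
  fixes code :: "'o \<times> 'm \<Rightarrow> 'p"
  assumes inj_code: "inj code"
begin

private abbreviation (input) "I \<equiv> idem_compl code"
private abbreviation (input) "ob \<equiv> idem_obj code"
private abbreviation (input) "mor \<equiv> idem_mor code"
private abbreviation (input) "IF \<equiv> idem_functor code"
private abbreviation (input) "IN \<equiv> idem_nt code"

text \<open>Injectivity of \<open>code\<close> makes \<open>inv code\<close> a left inverse. It
  enters here and in \<open>code_in_Obj\<close>; the rest of this context relies on it through these
  two facts.\<close>

lemma decode [simp]: "ob (code p) = fst p" "mor (code p) = snd p"
  by (simp_all add: idem_obj_def idem_mor_def inv_f_f[OF inj_code])

lemma code_in_Obj [simp]:
  "code (a, e) \<in> Obj (I C) \<longleftrightarrow> a \<in> Obj C \<and> e \<in> Hom C a a \<and> Comp C a a a e e = e"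
  using injD[OF inj_code] by (auto simp: idem_compl_def Let_def)

lemma Obj_idem:
  assumes "x \<in> Obj (I C)"
  shows "ob x \<in> Obj C" "mor x \<in> Hom C (ob x) (ob x)"
    "Comp C (ob x) (ob x) (ob x) (mor x) (mor x) = mor x" "code (ob x, mor x) = x"
proof -
  obtain a e where "x = code (a, e)"
    using assms by (auto simp: idem_compl_def Let_def)
  with assms show "ob x \<in> Obj C" "mor x \<in> Hom C (ob x) (ob x)"
    "Comp C (ob x) (ob x) (ob x) (mor x) (mor x) = mor x" "code (ob x, mor x) = x"
    by auto
qed

lemma Hom_idem:
  "X \<in> Hom (I C) x y \<longleftrightarrow> x \<in> Obj (I C) \<and> y \<in> Obj (I C) \<and> X \<in> Hom C (ob x) (ob y) \<and>
     Comp C (ob x) (ob y) (ob y) (mor y) X = X \<and> Comp C (ob x) (ob x) (ob y) X (mor x) = X"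
  by (auto simp: idem_compl_def Let_def)

lemma Idt_idem [simp]: "x \<in> Obj (I C) \<Longrightarrow> Idt (I C) x = mor x"
  by (simp add: idem_compl_def Let_def)

lemma Comp_idem [simp]: "Y \<in> Hom (I C) y z \<Longrightarrow> X \<in> Hom (I C) x y \<Longrightarrow>
    Comp (I C) x y z Y X = Comp C (ob x) (ob y) (ob z) Y X"
  by (simp add: idem_compl_def Let_def)

lemma idem_ext:
  "x \<notin> Obj (I C) \<Longrightarrow> Idt (I C) x = undefined"
  "\<not> (Y \<in> Hom (I C) y z \<and> X \<in> Hom (I C) x y) \<Longrightarrow> Comp (I C) x y z Y X = undefined"
  by (auto simp: idem_compl_def Let_def)

text \<open>Passing to the opposite exchanges the two absorption conditions on a morphism and keeps
  the condition that \<open>e\<close> is idempotent. As objects are coded alike on both sides, the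
  result is an equality, which lets the completion of \<open>d\<close> be a functor into the
  opposite of the completion.\<close>

lemma idem_op: "I (op_cat C) = op_cat (I C)"
proof (rule precategory.equality)
  show Ob: "Obj (I (op_cat C)) = Obj (op_cat (I C))"
    by (simp add: idem_compl_def Let_def)
  show Hom: "Hom (I (op_cat C)) = Hom (op_cat (I C))"
    using Ob by (intro ext set_eqI) (auto simp: Hom_idem)
  show "Idt (I (op_cat C)) = Idt (op_cat (I C))"
    by (simp add: idem_compl_def Let_def)
  show "Comp (I (op_cat C)) = Comp (op_cat (I C))"
  proof (intro ext)
    fix x y z Y X
    show "Comp (I (op_cat C)) x y z Y X = Comp (op_cat (I C)) x y z Y X"
    \<comment> \<open>Off the hom-sets both composites are \<open>undefined\<close>; the hom-sets
      agree with the roles of the two factors exchanged.\<close>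
    proof (cases "Y \<in> Hom (I (op_cat C)) y z \<and> X \<in> Hom (I (op_cat C)) x y")
      case True
      then have "Y \<in> Hom (I C) z y \<and> X \<in> Hom (I C) y x"
        by (simp add: Hom)
      with True show ?thesis
        by simp
    next
      case False
      then have "\<not> (X \<in> Hom (I C) y x \<and> Y \<in> Hom (I C) z y)"
        by (auto simp: Hom)
      with False show ?thesis
        by (simp add: idem_ext(2))
    qed
  qed
qed simp

lemma category_idem:
  assumes C: "category C"
  shows "category (I C)"
proof
  note [simp] = cat_simps[OF C] Obj_idem
  \<comment> \<open>The idempotent at the source meets \<open>X\<close> directly; the one at the
    target meets \<open>Y\<close> with \<open>X\<close> still composed on the right, which calls for
    \<open>comp_absorb\<close>.\<close>
  show cmp: "Comp (I C) x y z Y X \<in> Hom (I C) x z"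
    if "Y \<in> Hom (I C) y z" "X \<in> Hom (I C) x y" for x y z Y X
    unfolding Comp_idem[OF that] using that
      comp_absorb[OF C, of "ob y" "ob z" "ob z" "mor z" Y Y X "ob x"]
    by (simp add: Hom_idem)
  show "Comp (I C) x y w (Comp (I C) y z w Z Y) X = Comp (I C) x z w Z (Comp (I C) x y z Y X)"
    if "Z \<in> Hom (I C) z w" "Y \<in> Hom (I C) y z" "X \<in> Hom (I C) x y" for x y z w Z Y X
    \<comment> \<open>Composites of \<open>I C\<close> turn into those of \<open>C\<close> while
      membership in its hom-sets is still intact; only then is membership unfolded.\<close>
    using that cmp[OF that(1,2)] cmp[OF that(2,3)] by simp (simp add: Hom_idem)
  show id: "Idt (I C) x \<in> Hom (I C) x x" if "x \<in> Obj (I C)" for x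
    using that by (simp add: Hom_idem)
  show "Comp (I C) x x y X (Idt (I C) x) = X" "Comp (I C) x y y (Idt (I C) y) X = X"
    if "X \<in> Hom (I C) x y" for x y X
  proof -
    have "x \<in> Obj (I C)" "y \<in> Obj (I C)"
      using that by (auto simp: Hom_idem)
    with that id[of x] id[of y] show "Comp (I C) x x y X (Idt (I C) x) = X"
      "Comp (I C) x y y (Idt (I C) y) X = X"
      by simp_all (simp_all add: Hom_idem)
  qed
qed (simp_all add: Hom_idem idem_ext)

section \<open>Completion of functors\<close>

lemma idem_functor_simps [simp]:
  "Dom (IF F) = I (Dom F)" "Cod (IF F) = I (Cod F)"
  "x \<in> Obj (I (Dom F)) \<Longrightarrow> FOb (IF F) x = code (FOb F (ob x), FMor F (ob x) (ob x) (mor x))"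
  "X \<in> Hom (I (Dom F)) x y \<Longrightarrow> FMor (IF F) x y X = FMor F (ob x) (ob y) X"
  by (simp_all add: idem_functor_def Let_def)

text \<open>Functoriality carries the absorption equations of \<open>X\<close> over to its image.
  The last two clauses are their forms under a further composition, obtained by
  \<open>comp_absorb\<close> for use in nested composites.\<close>

lemma functor_Hom_idem:
  assumes F: "functor_between C D F" and X: "X \<in> Hom (I C) x y"
  shows "FMor F (ob x) (ob y) X \<in> Hom D (FOb F (ob x)) (FOb F (ob y))"
    "Comp D (FOb F (ob x)) (FOb F (ob y)) (FOb F (ob y)) (FMor F (ob y) (ob y) (mor y))
      (FMor F (ob x) (ob y) X) =
       FMor F (ob x) (ob y) X"
    "Comp D (FOb F (ob x)) (FOb F (ob x)) (FOb F (ob y)) (FMor F (ob x) (ob y) X)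
      (FMor F (ob x) (ob x) (mor x)) =
       FMor F (ob x) (ob y) X"
    "k \<in> Hom D z (FOb F (ob x)) \<Longrightarrow>
     Comp D z (FOb F (ob y)) (FOb F (ob y)) (FMor F (ob y) (ob y) (mor y))
       (Comp D z (FOb F (ob x)) (FOb F (ob y)) (FMor F (ob x) (ob y) X) k) =
     Comp D z (FOb F (ob x)) (FOb F (ob y)) (FMor F (ob x) (ob y) X) k"
    "k \<in> Hom D z (FOb F (ob x)) \<Longrightarrow>
     Comp D z (FOb F (ob x)) (FOb F (ob y)) (FMor F (ob x) (ob y) X)
       (Comp D z (FOb F (ob x)) (FOb F (ob x)) (FMor F (ob x) (ob x) (mor x)) k) =
     Comp D z (FOb F (ob x)) (FOb F (ob y)) (FMor F (ob x) (ob y) X) k"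
proof -
  note X' = X[unfolded Hom_idem]
  note [simp] = Obj_idem functor_simps[OF F]
  show 1: "FMor F (ob x) (ob y) X \<in> Hom D (FOb F (ob x)) (FOb F (ob y))"
    using X' by simp
  show 2: "Comp D (FOb F (ob x)) (FOb F (ob y)) (FOb F (ob y)) (FMor F (ob y) (ob y) (mor y))
    (FMor F (ob x) (ob y) X) =
       FMor F (ob x) (ob y) X"
    "Comp D (FOb F (ob x)) (FOb F (ob x)) (FOb F (ob y)) (FMor F (ob x) (ob y) X)
      (FMor F (ob x) (ob x) (mor x)) =
       FMor F (ob x) (ob y) X"
    using X' by (simp_all flip: functor_simps(6)[OF F])
  show "Comp D z (FOb F (ob y)) (FOb F (ob y)) (FMor F (ob y) (ob y) (mor y))
       (Comp D z (FOb F (ob x)) (FOb F (ob y)) (FMor F (ob x) (ob y) X) k) =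
     Comp D z (FOb F (ob x)) (FOb F (ob y)) (FMor F (ob x) (ob y) X) k"
    "Comp D z (FOb F (ob x)) (FOb F (ob y)) (FMor F (ob x) (ob y) X)
       (Comp D z (FOb F (ob x)) (FOb F (ob x)) (FMor F (ob x) (ob x) (mor x)) k) =
     Comp D z (FOb F (ob x)) (FOb F (ob y)) (FMor F (ob x) (ob y) X) k"
    if "k \<in> Hom D z (FOb F (ob x))"
    using that X' by (simp_all add: comp_absorb[OF functor_cats(2)[OF F] 2(1)]
      comp_absorb[OF functor_cats(2)[OF F] 2(2)])
qed

lemma mor_Hom_idem: "category C \<Longrightarrow> x \<in> Obj (I C) \<Longrightarrow> mor x \<in> Hom (I C) x x"
  by (simp add: Hom_idem Obj_idem)

text \<open>The case \<open>X = mor x\<close> of the preceding facts: an idempotent is a morphism of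
  the completion, namely the identity of its object.\<close>

lemma functor_Obj_idem:
  assumes F: "functor_between C D F" and x: "x \<in> Obj (I C)"
  shows "FOb F (ob x) \<in> Obj D" "FMor F (ob x) (ob x) (mor x) \<in> Hom D (FOb F (ob x)) (FOb F (ob x))"
    "Comp D (FOb F (ob x)) (FOb F (ob x)) (FOb F (ob x)) (FMor F (ob x) (ob x) (mor x))
      (FMor F (ob x) (ob x) (mor x)) =
       FMor F (ob x) (ob x) (mor x)"
    "k \<in> Hom D z (FOb F (ob x)) \<Longrightarrow>
     Comp D z (FOb F (ob x)) (FOb F (ob x)) (FMor F (ob x) (ob x) (mor x))
       (Comp D z (FOb F (ob x)) (FOb F (ob x)) (FMor F (ob x) (ob x) (mor x)) k) =
     Comp D z (FOb F (ob x)) (FOb F (ob x)) (FMor F (ob x) (ob x) (mor x)) k"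
  using functor_Hom_idem[OF F mor_Hom_idem[OF functor_cats(1)[OF F] x]] x
  by (auto simp: functor_simps(3)[OF F] Obj_idem)

text \<open>The identity of an object of the completion is its idempotent \<open>e\<close>, and
  \<open>F e\<close> is by construction the identity of the image object.\<close>

lemma functor_idem:
  assumes F: "functor_between C D F"
  shows "functor_between (I C) (I D) (IF F)"
proof (rule functor_betweenI)
  note [simp] = functor_simps(1-3)[OF F] functor_Obj_idem[OF F] functor_Hom_idem[OF F] Obj_idem
  note CI = category_idem[OF functor_cats(1)[OF F]]
  show "category (I C)" "category (I D)"
    by (simp_all add: CI category_idem functor_cats(2)[OF F])
  show Ob: "FOb (IF F) x \<in> Obj (I D)" if "x \<in> Obj (I C)" for x
    using that by simp
  show Mor: "FMor (IF F) x y X \<in> Hom (I D) (FOb (IF F) x) (FOb (IF F) y)"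
    if "x \<in> Obj (I C)" "y \<in> Obj (I C)" "X \<in> Hom (I C) x y" for x y X
    using that Ob[OF that(1)] Ob[OF that(2)] by (simp add: Hom_idem[of _ D])
  show "FOb (IF F) x = undefined" if "x \<notin> Obj (I C)" for x
    using that by (simp add: idem_functor_def)
  show "FMor (IF F) x y X = undefined" if "X \<notin> Hom (I C) x y" for x y X
    using that by (simp add: idem_functor_def)
  show "FMor (IF F) x x (Idt (I C) x) = Idt (I D) (FOb (IF F) x)" if "x \<in> Obj (I C)" for x
    using that by (simp add: mor_Hom_idem functor_cats[OF F])
  show "FMor (IF F) x z (Comp (I C) x y z Y X) =
      Comp (I D) (FOb (IF F) x) (FOb (IF F) y) (FOb (IF F) z) (FMor (IF F) y z Y) (FMor (IF F) x y X)"
    if "x \<in> Obj (I C)" "y \<in> Obj (I C)" "z \<in> Obj (I C)" "Y \<in> Hom (I C) y z" "X \<in> Hom (I C) x y" for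
      x y z Y X
  proof -
    have XY: "X \<in> Hom C (ob x) (ob y)" "Y \<in> Hom C (ob y) (ob z)"
      using that by (auto simp: Hom_idem)
    \<comment> \<open>\<open>FMor (IF F)\<close> and the composition of \<open>I D\<close> evaluate
      only on morphisms of the completions, so membership is supplied for the composite and for both
      images.\<close>
    have "Comp (I C) x y z Y X \<in> Hom (I C) x z"
      by (rule cat_simps(2)[OF CI that(4,5)])
    moreover note Mor[OF that(2,3,4)] Mor[OF that(1,2,5)]
    ultimately show ?thesis
      using that XY by (simp add: functor_simps(6)[OF F])
  qed
qed (simp_all add: functor_simps(1,2)[OF F])

lemma idem_functor_comp:
  assumes F: "functor_between C D F" and G: "functor_between D E G"
  shows "IF (G \<circ>\<^sub>F F) = IF G \<circ>\<^sub>F IF F"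
proof (rule functor_eqI[OF functor_idem[OF functor_comp[OF F G]]
  functor_comp[OF functor_idem[OF F] functor_idem[OF G]]])
  note [simp] = functor_simps(1-2)[OF F] functor_simps(1-2)[OF G] Obj_idem
    functor_simps(3,4)[OF functor_idem[OF F], simplified]
  show "FOb (IF (G \<circ>\<^sub>F F)) x = FOb (IF G \<circ>\<^sub>F IF F) x" if "x \<in> Obj (I C)" for x
    using that functor_simps(3)[OF functor_idem[OF F] that] by simp
  show "FMor (IF (G \<circ>\<^sub>F F)) x y X = FMor (IF G \<circ>\<^sub>F IF F) x y X"
    if "x \<in> Obj (I C)" "y \<in> Obj (I C)" "X \<in> Hom (I C) x y" for x y X
    using that functor_simps(4)[OF functor_idem[OF F] that(3)] by (simp add: Hom_idem[of _ C])
qed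

lemma idem_functor_op: "IF (op_functor F) = op_functor (IF F)"
  by (simp add: idem_functor_def op_functor_def idem_op)

lemma idem_functor_id: "category C \<Longrightarrow> IF (id_functor C) = id_functor (I C)"
  by (rule functor_eqI[OF functor_idem[OF functor_id] functor_id[OF category_idem]])
    (auto simp: Obj_idem Hom_idem)

section \<open>Completion of transformations\<close>

lemma idem_nt_simps [simp]:
  "Src (IN \<tau>) = IF (Src \<tau>)" "Trg (IN \<tau>) = IF (Trg \<tau>)"
  "x \<in> Obj (I (Dom (Src \<tau>))) \<Longrightarrow> component (IN \<tau>) x =
    Comp (Cod (Src \<tau>)) (FOb (Src \<tau>) (ob x)) (FOb (Src \<tau>) (ob x)) (FOb (Trg \<tau>) (ob x))
      (component \<tau> (ob x)) (FMor (Src \<tau>) (ob x) (ob x) (mor x))"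
  by (simp_all add: idem_nt_def Let_def)

text \<open>By naturality \<open>\<tau> a \<circ> F e = G e \<circ> \<tau> a\<close>, so the
  component absorbs the idempotents at both ends and is a morphism of the completion. In the new
  square both sides reduce to \<open>G X \<circ> \<tau> a\<close>.\<close>

lemma nt_idem:
  assumes \<tau>: "nt_between C D F G \<tau>"
  shows "nt_between (I C) (I D) (IF F) (IF G) (IN \<tau>)"
proof (rule nt_betweenI)
  note F = nt_functors(1)[OF \<tau>] and G = nt_functors(2)[OF \<tau>]
  note [simp] = functor_simps(1,2)[OF F] functor_simps(1,2)[OF G] nt_simps[OF \<tau>]
    functor_Obj_idem[OF F] functor_Obj_idem[OF G] functor_Hom_idem[OF F] functor_Hom_idem[OF G]
    Obj_idem nt_natural[OF \<tau>] nt_natural_comp[OF \<tau>] cat_simps[OF functor_cats(2)[OF F]]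
  show "functor_between (I C) (I D) (IF F)" "functor_between (I C) (I D) (IF G)"
    by (simp_all add: functor_idem F G)
  show mem: "component (IN \<tau>) x \<in> Hom (I D) (FOb (IF F) x) (FOb (IF G) x)" if "x \<in> Obj (I C)" for x
    using that functor_simps(3)[OF functor_idem[OF F] that] functor_simps(3)[OF functor_idem[OF G] that]
    by (simp add: Hom_idem[of _ D])
  show "component (IN \<tau>) x = undefined" if "x \<notin> Obj (I C)" for x
    using that by (simp add: idem_nt_def)
  show "Comp (I D) (FOb (IF F) x) (FOb (IF F) y) (FOb (IF G) y) (component (IN \<tau>) y)
    (FMor (IF F) x y X) =
      Comp (I D) (FOb (IF F) x) (FOb (IF G) x) (FOb (IF G) y) (FMor (IF G) x y X) (component (IN \<tau>) x)"
    if "x \<in> Obj (I C)" "y \<in> Obj (I C)" and X: "X \<in> Hom (I C) x y" for x y X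
  proof -
    have X': "X \<in> Hom C (ob x) (ob y)"
      using X by (simp add: Hom_idem)
    show ?thesis
      unfolding Comp_idem[OF mem[OF that(2)] functor_simps(4)[OF functor_idem[OF F] X]]
        Comp_idem[OF functor_simps(4)[OF functor_idem[OF G] X] mem[OF that(1)]]
      using that X' by simp
  qed
qed (simp_all add: nt_simps(1,2)[OF \<tau>])

lemma idem_nt_id:
  assumes F: "functor_between C D F"
  shows "IN (id_nt F) = id_nt (IF F)"
  by (rule nt_eqI[OF nt_idem[OF nt_id[OF F]] nt_id[OF functor_idem[OF F]]])
    (simp add: functor_simps(1-2)[OF F] functor_Obj_idem[OF F] Obj_idem
      cat_simps[OF functor_cats(2)[OF F]])

text \<open>The completed component carries its idempotent on the source side, and the source of
  \<open>op_nt \<tau>\<close> comes from the target of \<tau>. One side is thus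
  \<open>G e \<circ> \<tau> a\<close>, the other \<open>\<tau> a \<circ> F e\<close>, and naturality
  identifies them.\<close>

lemma idem_nt_op:
  assumes \<tau>: "nt_between C D F G \<tau>"
  shows "IN (op_nt \<tau>) = op_nt (IN \<tau>)"
proof (rule nt_eqI)
  note F = nt_functors(1)[OF \<tau>] and G = nt_functors(2)[OF \<tau>]
  show "nt_between (op_cat (I C)) (op_cat (I D)) (op_functor (IF G)) (op_functor (IF F)) (IN (op_nt \<tau>))"
    using nt_idem[OF nt_op[OF \<tau>]] by (simp add: idem_op idem_functor_op)
  show "nt_between (op_cat (I C)) (op_cat (I D)) (op_functor (IF G)) (op_functor (IF F)) (op_nt (IN \<tau>))"
    by (rule nt_op[OF nt_idem[OF \<tau>]])
  show "component (IN (op_nt \<tau>)) x = component (op_nt (IN \<tau>)) x" if "x \<in> Obj (op_cat (I C))" for x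
    using that by (simp add: functor_simps(1,2)[OF F] functor_simps(1,2)[OF G] nt_simps[OF \<tau>] Obj_idem
      idem_op nt_natural[OF \<tau>])
qed

text \<open>Each factor on the right brings its own idempotent; naturality places them next to each
  other, where they merge into one.\<close>

lemma idem_nt_vcomp:
  assumes \<sigma>: "nt_between C D G H \<sigma>" and \<tau>: "nt_between C D F G \<tau>"
  shows "IN (\<sigma> \<bullet>\<^sub>V \<tau>) = IN \<sigma> \<bullet>\<^sub>V IN \<tau>"
proof (rule nt_eqI[OF nt_idem[OF nt_vcomp[OF \<sigma> \<tau>]] nt_vcomp[OF nt_idem[OF \<sigma>] nt_idem[OF \<tau>]]])
  note F = nt_functors(1)[OF \<tau>] and G = nt_functors(2)[OF \<tau>] and H = nt_functors(2)[OF \<sigma>]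
  note [simp] = functor_simps(1,2)[OF F] functor_simps(1,2)[OF G] functor_simps(1,2)[OF H]
    nt_simps[OF \<tau>] nt_simps[OF \<sigma>]
    functor_Obj_idem[OF F] functor_Obj_idem[OF G] functor_Obj_idem[OF H]
    Obj_idem nt_natural[OF \<tau>] nt_natural_comp[OF \<tau>] nt_natural[OF \<sigma>] nt_natural_comp[OF \<sigma>]
    cat_simps[OF functor_cats(2)[OF F]]
  fix x assume x: "x \<in> Obj (I C)"
  have "component (IN \<sigma> \<bullet>\<^sub>V IN \<tau>) x = Comp (I D) (FOb (IF F) x) (FOb (IF G) x) (FOb (IF H) x)
      (component (IN \<sigma>) x) (component (IN \<tau>) x)"
    using x by simp
  also have "\<dots> = Comp D (FOb F (ob x)) (FOb G (ob x)) (FOb H (ob x)) (component (IN \<sigma>) x)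
    (component (IN \<tau>) x)"
    unfolding Comp_idem[OF nt_simps(3)[OF nt_idem[OF \<sigma>] x] nt_simps(3)[OF nt_idem[OF \<tau>] x]]
    using x by simp
  finally show "component (IN (\<sigma> \<bullet>\<^sub>V \<tau>)) x = component (IN \<sigma> \<bullet>\<^sub>V IN \<tau>) x"
    using x by simp
qed

text \<open>On the right, idempotents come from both factors: \<open>G (F' e)\<close> from the
  completed \<sigma> and \<open>G (F e)\<close> from the completed \<tau>. Naturality and
  idempotence leave one of them, as on the left.\<close>

lemma idem_nt_hcomp:
  assumes \<sigma>: "nt_between D E G G' \<sigma>" and \<tau>: "nt_between C D F F' \<tau>"
  shows "IN (\<sigma> \<circ>\<^sub>H \<tau>) = IN \<sigma> \<circ>\<^sub>H IN \<tau>"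
proof (rule nt_eqI)
  note F = nt_functors(1)[OF \<tau>] and F' = nt_functors(2)[OF \<tau>]
    and G = nt_functors(1)[OF \<sigma>] and G' = nt_functors(2)[OF \<sigma>]
  show "nt_between (I C) (I E) (IF G \<circ>\<^sub>F IF F) (IF G' \<circ>\<^sub>F IF F') (IN (\<sigma> \<circ>\<^sub>H \<tau>))"
    using nt_idem[OF nt_hcomp[OF \<sigma> \<tau>]] by (simp add: idem_functor_comp[OF F G]
      idem_functor_comp[OF F' G'])
  show "nt_between (I C) (I E) (IF G \<circ>\<^sub>F IF F) (IF G' \<circ>\<^sub>F IF F') (IN \<sigma> \<circ>\<^sub>H IN \<tau>)"
    by (rule nt_hcomp[OF nt_idem[OF \<sigma>] nt_idem[OF \<tau>]])
  note [simp] = functor_simps[OF F] functor_simps[OF F'] functor_simps[OF G] functor_simps[OF G']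
    nt_simps[OF \<tau>] nt_simps[OF \<sigma>]
    functor_Obj_idem[OF F] functor_Obj_idem[OF F'] 
    Obj_idem nt_natural[OF \<tau>] nt_natural_comp[OF \<tau>] nt_natural[OF \<sigma>] nt_natural_comp[OF \<sigma>]
    cat_simps[OF functor_cats(2)[OF F]] cat_simps[OF functor_cats(2)[OF G]]
  fix x assume x: "x \<in> Obj (I C)"
  note Fx = functor_simps(3)[OF functor_idem[OF F] x] and Fx' =
    functor_simps(3)[OF functor_idem[OF F'] x]
  note \<tau>x = nt_simps(3)[OF nt_idem[OF \<tau>] x]
  have "component (IN \<sigma> \<circ>\<^sub>H IN \<tau>) x = Comp (I E) (FOb (IF G) (FOb (IF F) x)) (FOb (IF G) (FOb (IF F') x))
      (FOb (IF G') (FOb (IF F') x)) (component (IN \<sigma>) (FOb (IF F') x))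
      (FMor (IF G) (FOb (IF F) x) (FOb (IF F') x) (component (IN \<tau>) x))"
    using x by simp
  also have "\<dots> = Comp E (FOb G (FOb F (ob x))) (FOb G (FOb F' (ob x))) (FOb G' (FOb F' (ob x)))
      (component (IN \<sigma>) (FOb (IF F') x)) (FMor G (FOb F (ob x)) (FOb F' (ob x)) (component (IN \<tau>) x))"
    unfolding Comp_idem[OF nt_simps(3)[OF nt_idem[OF \<sigma>] Fx'] functor_simps(4)[OF functor_idem[OF G] \<tau>x]]
    using x Fx Fx' \<tau>x by simp
  also have "\<dots> = component (IN (\<sigma> \<circ>\<^sub>H \<tau>)) x"
  proof -
    have e: "mor x \<in> Hom C (ob x) (ob x)"
      using x by simp
    \<comment> \<open>The composites of \<open>G'\<close> with \<open>F'\<close> and of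
      \<open>G\<close> with \<open>F'\<close> and \<open>F\<close> preserve idempotents, and the
      square of \<open>\<sigma> \<circ>\<^sub>H \<tau>\<close> at \<open>e\<close> moves the
      remaining one across.\<close>
    show ?thesis
      using x Fx' e functor_Obj_idem(3,4)[OF functor_comp[OF F' G'] x]
        functor_Obj_idem(3,4)[OF functor_comp[OF F' G] x]
        functor_Obj_idem(3,4)[OF functor_comp[OF F G] x]
        nt_natural[OF nt_hcomp[OF \<sigma> \<tau>] e]
      by simp
  qed
  finally show "component (IN (\<sigma> \<circ>\<^sub>H \<tau>)) x = component (IN \<sigma> \<circ>\<^sub>H IN \<tau>) x"
    by simp
qed

lemma idem_iso:
  assumes \<tau>: "nt_between C D F G \<tau>" and x: "x \<in> Obj (I C)"
    and iso: "iso_mor D (FOb F (ob x)) (FOb G (ob x)) (component \<tau> (ob x))"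
  shows "iso_mor (I D) (FOb (IF F) x) (FOb (IF G) x) (component (IN \<tau>) x)"
proof -
  note F = nt_functors(1)[OF \<tau>] and G = nt_functors(2)[OF \<tau>]
  note [simp] = functor_simps(1,2)[OF F] functor_simps(1,2)[OF G] nt_simps[OF \<tau>]
    functor_Obj_idem[OF F] functor_Obj_idem[OF G] Obj_idem
    nt_natural[OF \<tau>] nt_natural_comp[OF \<tau>] cat_simps[OF functor_cats(2)[OF F]]
  note DD = functor_cats(2)[OF F]
  let ?a = "FOb F (ob x)" and ?b = "FOb G (ob x)" and ?t = "component \<tau> (ob x)"
  let ?e = "FMor F (ob x) (ob x) (mor x)" and ?f = "FMor G (ob x) (ob x) (mor x)"
  obtain g where g: "g \<in> Hom D ?b ?a" "Comp D ?a ?b ?a g ?t = Idt D ?a"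
    "Comp D ?b ?a ?b ?t g = Idt D ?b"
    using iso by (auto simp: iso_mor_def inverse_pair_def)
  have t: "?t \<in> Hom D ?a ?b"
    using x by simp
  have gt: "Comp D z ?b ?a g (Comp D z ?a ?b ?t k) = k" if "k \<in> Hom D z ?a" for z k
    using comp_absorb[OF DD g(2,1) t that] that by simp
  have tg: "Comp D z ?a ?b ?t (Comp D z ?b ?a g k) = k" if "k \<in> Hom D z ?b" for z k
    using comp_absorb[OF DD g(3) t g(1) that] that by simp
  \<comment> \<open>\<tau> intertwines \<open>F e\<close> and \<open>G e\<close>, so its inverse
    \<open>g\<close> intertwines them in the other direction; hence \<open>F e \<circ> g\<close>
    absorbs \<open>G e\<close> as well.\<close>
  have gf: "Comp D ?b ?b ?a g ?f = Comp D ?b ?a ?a ?e g"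
  proof -
    \<comment> \<open>Naturality is withheld from the simplifier, as it would rewrite the inner
      composite before \<open>g\<close> can cancel \<open>?t\<close>.\<close>
    have "Comp D ?b ?a ?a ?e g = Comp D ?b ?b ?a g (Comp D ?b ?a ?b ?t (Comp D ?b ?a ?a ?e g))"
      using x g(1) by (simp add: gt del: nt_natural_comp[OF \<tau>])
    also have "\<dots> = Comp D ?b ?b ?a g ?f"
      using x g by simp
    finally show ?thesis ..
  qed
  define h where "h = Comp D ?b ?a ?a ?e g"
  have Fx: "FOb (IF F) x \<in> Obj (I D)" and Gx: "FOb (IF G) x \<in> Obj (I D)"
    using functor_simps(3)[OF functor_idem[OF F] x] functor_simps(3)[OF functor_idem[OF G] x] .
  have h: "h \<in> Hom (I D) (FOb (IF G) x) (FOb (IF F) x)"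
    using x g(1) Fx Gx by (simp add: Hom_idem[of _ D] h_def gf)
  have gf': "Comp D z ?b ?a g (Comp D z ?b ?b ?f k) = Comp D z ?a ?a ?e (Comp D z ?b ?a g k)"
    if "k \<in> Hom D z ?b" for z k
    using comp_absorb[OF DD gf g(1) functor_Obj_idem(2)[OF G x] that] that g(1) x by simp
  note IN = nt_simps(3)[OF nt_idem[OF \<tau>] x]
  have "inverse_pair (I D) (FOb (IF F) x) (FOb (IF G) x) (component (IN \<tau>) x) h"
    unfolding inverse_pair_def Comp_idem[OF h IN] Comp_idem[OF IN h] Idt_idem[OF Fx] Idt_idem[OF Gx]
  proof (intro conjI h IN)
    show "Comp D (ob (FOb (IF F) x)) (ob (FOb (IF G) x)) (ob (FOb (IF F) x)) h (component (IN \<tau>) x) =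
        mor (FOb (IF F) x)"
      "Comp D (ob (FOb (IF G) x)) (ob (FOb (IF F) x)) (ob (FOb (IF G) x)) (component (IN \<tau>) x) h =
        mor (FOb (IF G) x)"
      using x g by (simp_all add: h_def gf')
  qed
  then show ?thesis
    by (auto simp: iso_mor_def)
qed

end

section \<open>The induced volutive structure\<close>

text \<open>Let \<open>x\<close> store \<open>(a, e)\<close> and let \<open>?e1\<close>,
  \<open>?e2\<close>, \<open>?e3\<close> be the images of \<open>e\<close> under repeated use of
  \<open>d\<close>. The component at the dual of \<open>x\<close> is
  \<open>\<eta> (d a) \<circ> ?e3\<close>, and the dual of the component at \<open>x\<close> is
  \<open>?e3 \<circ> d (\<eta> a)\<close>. Their two composites are \<open>?e1\<close> and
  \<open>?e3\<close>, the identities of the objects concerned.\<close>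

lemma volutive_structure_idem:
  assumes code: "inj code" and V: "volutive_structure C d \<eta>"
  shows "volutive_structure (idem_compl code C) (idem_functor code d) (idem_nt code \<eta>)"
proof -
  let ?I = "idem_compl code" and ?IF = "idem_functor code" and ?IN = "idem_nt code"
    and ?ob = "idem_obj code" and ?mor = "idem_mor code"
  note V = V[unfolded volutive_structure_iff]
  have d: "functor_between C (op_cat C) d"
    and \<eta>: "nt_between C C (op_functor d \<circ>\<^sub>F d) (id_functor C) \<eta>"
    and iso: "\<And>a. a \<in> Obj C \<Longrightarrow> iso_mor C (FOb d (FOb d a)) a (component \<eta> a)"
    and inv: "\<And>a. a \<in> Obj C \<Longrightarrow>
      inverse_pair C (FOb d (FOb d (FOb d a))) (FOb d a) (component \<eta> (FOb d a))
        (FMor d (FOb d (FOb d a)) a (component \<eta> a))"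
    using V by auto
  note C = functor_cats(1)[OF d]
  note [simp] = decode[OF code]
  have Id: "functor_between (?I C) (op_cat (?I C)) (?IF d)"
    using functor_idem[OF code d] by (simp add: idem_op[OF code])
  have I\<eta>: "nt_between (?I C) (?I C) (op_functor (?IF d) \<circ>\<^sub>F ?IF d) (id_functor (?I C)) (?IN \<eta>)"
    using nt_idem[OF code \<eta>]
    by (simp add: idem_functor_comp[OF code d functor_op[OF d]] idem_functor_op[OF code]
        idem_functor_id[OF code C])
  note [simp] = contra_simps[OF d] Obj_idem[OF code] nt_simps(1,2)[OF \<eta>]
    idem_nt_simps[OF code] idem_functor_simps[OF code] cat_simps[OF C]
  have Iob: "FOb (?IF d) x \<in> Obj (?I C)" if "x \<in> Obj (?I C)" for x
    using contra_simps(3)[OF Id that] .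
  show ?thesis
    unfolding volutive_structure_iff
  proof (intro conjI ballI Id I\<eta>)
    fix x assume x: "x \<in> Obj (?I C)"
    show "iso_mor (?I C) (FOb (?IF d) (FOb (?IF d) x)) x (component (?IN \<eta>) x)"
      using idem_iso[OF code \<eta> x] x iso[of "?ob x"] Iob[OF x] Iob[OF Iob[OF x]]
      by simp
    let ?a = "?ob x" and ?e = "?mor x"
    let ?d1 = "FOb d ?a" let ?d2 = "FOb d ?d1" let ?d3 = "FOb d ?d2" let ?d4 = "FOb d ?d3"
    let ?e1 = "FMor d ?a ?a ?e" let ?e2 = "FMor d ?d1 ?d1 ?e1" let ?e3 = "FMor d ?d2 ?d2 ?e2"
    have a: "?a \<in> Obj C"
      using x by simp
    note inv_a = inv[OF a, unfolded inverse_pair_def]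
    have \<eta>a: "component \<eta> ?a \<in> Hom C ?d2 ?a" "component \<eta> ?d1 \<in> Hom C ?d3 ?d1"
      using iso_mor_Hom[OF iso] a by auto
    have e: "?e \<in> Hom C ?a ?a" "Comp C ?a ?a ?a ?e ?e = ?e"
      using x by auto
    have e1: "?e1 \<in> Hom C ?d1 ?d1" "Comp C ?d1 ?d1 ?d1 ?e1 ?e1 = ?e1"
      using e a by (auto simp flip: contra_simps(6)[OF d])
    have e2: "?e2 \<in> Hom C ?d2 ?d2" "Comp C ?d2 ?d2 ?d2 ?e2 ?e2 = ?e2"
      using e1 a by (auto simp flip: contra_simps(6)[OF d])
    have e3: "?e3 \<in> Hom C ?d3 ?d3" "Comp C ?d3 ?d3 ?d3 ?e3 ?e3 = ?e3"
      using e2 a by (auto simp flip: contra_simps(6)[OF d])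
    \<comment> \<open>Naturality of \<eta> at \<open>?e1\<close>, whose double dual is
      \<open>?e3\<close>.\<close>
    have nat: "Comp C ?d3 ?d3 ?d1 (component \<eta> ?d1) ?e3 = Comp C ?d3 ?d1 ?d1 ?e1 (component \<eta> ?d1)"
      using nt_natural[OF \<eta> e1(1)] e1 a by simp
    have x1: "FOb (?IF d) x = code (?d1, ?e1)" and x2: "FOb (?IF d) (FOb (?IF d) x) = code (?d2, ?e2)"
      and x3: "FOb (?IF d) (FOb (?IF d) (FOb (?IF d) x)) = code (?d3, ?e3)"
      using x Iob[OF x] Iob[OF Iob[OF x]] by simp_all
    note ob = Iob[OF x] Iob[OF Iob[OF x]] Iob[OF Iob[OF Iob[OF x]]]
    have E1: "component (?IN \<eta>) (FOb (?IF d) x) = Comp C ?d3 ?d3 ?d1 (component \<eta> ?d1) ?e3"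
      using x Iob[OF x] e1 by (simp add: x1)
    have E0: "component (?IN \<eta>) x = Comp C ?d2 ?d2 ?a (component \<eta> ?a) ?e2"
      using x e by simp
    have m1: "component (?IN \<eta>) (FOb (?IF d) x) \<in> Hom (?I C)
      (FOb (?IF d) (FOb (?IF d) (FOb (?IF d) x))) (FOb (?IF d) x)"
      using nt_simps(3)[OF I\<eta> ob(1)] ob contra_simps(1)[OF Id] by simp
    have m0: "component (?IN \<eta>) x \<in> Hom (?I C) (FOb (?IF d) (FOb (?IF d) x)) x"
      using nt_simps(3)[OF I\<eta> x] x contra_simps(1)[OF Id] by simp
    have m2: "FMor (?IF d) (FOb (?IF d) (FOb (?IF d) x)) x (component (?IN \<eta>) x) \<in>
        Hom (?I C) (FOb (?IF d) x) (FOb (?IF d) (FOb (?IF d) (FOb (?IF d) x)))"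
      using contra_simps(4)[OF Id m0] .
    \<comment> \<open>\<open>d\<close> reverses the composite in \<open>E0\<close>, so the
      idempotent, now \<open>?e3\<close>, stands on the left.\<close>
    have E2: "FMor (?IF d) (FOb (?IF d) (FOb (?IF d) x)) x (component (?IN \<eta>) x) =
        Comp C ?d1 ?d3 ?d3 ?e3 (FMor d ?d2 ?a (component \<eta> ?a))"
      unfolding idem_functor_simps(4)[OF code, of _ d, unfolded contra_simps(1)[OF d], OF m0]
      unfolding E0 x2 using e2 \<eta>a by simp
    have abs: "Comp C ?d1 ?d3 ?d3 ?e3 (Comp C ?d1 ?d3 ?d3 ?e3 k) = Comp C ?d1 ?d3 ?d3 ?e3 k"
      if "k \<in> Hom C ?d1 ?d3" for k
      using comp_absorb[OF C e3(2) e3(1) e3(1)] that by auto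
    have cancel: "Comp C z ?d1 ?d3 (FMor d ?d2 ?a (component \<eta> ?a))
        (Comp C z ?d3 ?d1 (component \<eta> ?d1) l) = l" if "l \<in> Hom C z ?d3" for z l
      using comp_absorb[OF C inv_a[THEN conjunct2, THEN conjunct2, THEN conjunct1]] inv_a that by auto
    show "inverse_pair (?I C) (FOb (?IF d) (FOb (?IF d) (FOb (?IF d) x))) (FOb (?IF d) x)
      (component (?IN \<eta>) (FOb (?IF d) x)) (FMor (?IF d) (FOb (?IF d) (FOb (?IF d) x)) x
        (component (?IN \<eta>) x))"
      unfolding inverse_pair_def Comp_idem[OF code m1 m2] Comp_idem[OF code m2 m1]
        Idt_idem[OF code ob(1)] Idt_idem[OF code ob(3)]
    proof (intro conjI m1 m2)
      \<comment> \<open>The two copies of \<open>?e3\<close> merge, \<open>nat\<close> turns the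
        remaining one into \<open>?e1\<close> on the left, and the inverse pair cancels.\<close>
      have "Comp C ?d1 ?d3 ?d1 (Comp C ?d3 ?d3 ?d1 (component \<eta> ?d1) ?e3)
          (Comp C ?d1 ?d3 ?d3 ?e3 (FMor d ?d2 ?a (component \<eta> ?a))) =
        Comp C ?d1 ?d3 ?d1 (Comp C ?d3 ?d3 ?d1 (component \<eta> ?d1) ?e3) (FMor d ?d2 ?a (component \<eta> ?a))"
        using inv_a e3 abs by simp
      also have "\<dots> = ?e1"
        unfolding nat using inv_a e1 by simp
      finally show "Comp C (?ob (FOb (?IF d) x)) (?ob (FOb (?IF d) (FOb (?IF d) (FOb (?IF d) x))))
           (?ob (FOb (?IF d) x)) (component (?IN \<eta>) (FOb (?IF d) x))
           (FMor (?IF d) (FOb (?IF d) (FOb (?IF d) x)) x (component (?IN \<eta>) x)) = ?mor (FOb (?IF d) x)"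
        unfolding E1 E2 unfolding x3 unfolding x1 by simp
      \<comment> \<open>In this order the inverse pair stands in the middle; cancelling it leaves
        two copies of \<open>?e3\<close>.\<close>
      have "Comp C ?d3 ?d1 ?d3 (Comp C ?d1 ?d3 ?d3 ?e3 (FMor d ?d2 ?a (component \<eta> ?a)))
         (Comp C ?d3 ?d3 ?d1 (component \<eta> ?d1) ?e3) = ?e3"
        using inv_a e3 by (simp add: cancel)
      then show "Comp C (?ob (FOb (?IF d) (FOb (?IF d) (FOb (?IF d) x)))) (?ob (FOb (?IF d) x))
           (?ob (FOb (?IF d) (FOb (?IF d) (FOb (?IF d) x))))
           (FMor (?IF d) (FOb (?IF d) (FOb (?IF d) x)) x (component (?IN \<eta>) x))
           (component (?IN \<eta>) (FOb (?IF d) x)) = ?mor (FOb (?IF d) (FOb (?IF d) (FOb (?IF d) x)))"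
        unfolding E1 E2 unfolding x3 unfolding x1 by simp
    qed
  qed
qed

section \<open>The completion of 1- and 2-morphisms\<close>

lemma idem_volutive_simps [simp]:
  "UCat (idem_volutive code V) = idem_compl code (UCat V)"
  "dual (idem_volutive code V) = idem_functor code (dual V)"
  "eta (idem_volutive code V) = idem_nt code (eta V)"
  by (simp_all add: idem_volutive_def)

lemma volutive_category_idem:
  "inj code \<Longrightarrow> volutive_category V \<Longrightarrow> volutive_category (idem_volutive code V)"
  by (simp add: volutive_category_def volutive_structure_idem)

text \<open>Written with projections so that it can be the right-hand side of a rewrite rule for a
  pair not yet split.\<close>

abbreviation idem_vol_mor :: "('o \<times> 'm \<Rightarrow> 'p) \<Rightarrow> ('o, 'm) vol_mor \<Rightarrow> ('p, 'm) vol_mor" where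
  "idem_vol_mor code M \<equiv> (idem_functor code (fst M), idem_nt code (snd M))"

context
  fixes code :: "'o \<times> 'm \<Rightarrow> 'p"
  assumes code: "inj code"
begin

text \<open>The pasting law is transported without components: the completion is applied to both
  sides of the given equation and distributes over opposites, identities and both
  compositions.\<close>

lemma vol_functor_idem:
  assumes M: "vol_functor V W M"
  shows "vol_functor (idem_volutive code V) (idem_volutive code W) (idem_vol_mor code M)"
proof -
  obtain F \<alpha> where eqs [simp]: "M = (F, \<alpha>)"
    by (cases M)
  note M = M[simplified]
  note V = vol_functorD(1)[OF M] and W = vol_functorD(2)[OF M] and F = vol_functorD(3)[OF M]
    and \<alpha> = vol_functorD(4)[OF M]
  note dV = volutive_category_simps(2)[OF V] and dW = volutive_category_simps(2)[OF W]
    and eV = volutive_category_simps(3)[OF V] and eW = volutive_category_simps(3)[OF W]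
  note dW' = functor_op[OF dW, unfolded op_cat_simps]
  note [simp] = idem_op[OF code] idem_functor_op[OF code] idem_nt_op[OF code \<alpha>]
    idem_functor_comp[OF code dV functor_op[OF F]] idem_functor_comp[OF code F dW]
    functor_simps(1,2)[OF F]
  have IF: "functor_between (idem_compl code (UCat V)) (idem_compl code (UCat W)) (idem_functor code F)"
    by (rule functor_idem[OF code F])
  have I\<alpha>: "nt_between (idem_compl code (UCat V)) (op_cat (idem_compl code (UCat W)))
      (op_functor (idem_functor code F) \<circ>\<^sub>F idem_functor code (dual V))
      (idem_functor code (dual W) \<circ>\<^sub>F idem_functor code F) (idem_nt code \<alpha>)"
    using nt_idem[OF code \<alpha>] by simp
  have iso: "nat_iso (op_functor (idem_functor code F) \<circ>\<^sub>F idem_functor code (dual V))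
      (idem_functor code (dual W) \<circ>\<^sub>F idem_functor code F) (idem_nt code \<alpha>)"
    unfolding nat_iso_iff[OF nt_functors[OF I\<alpha>]]
  proof (intro conjI ballI I\<alpha>)
    fix x assume x: "x \<in> Obj (idem_compl code (UCat V))"
    show "iso_mor (op_cat (idem_compl code (UCat W)))
        (FOb (op_functor (idem_functor code F) \<circ>\<^sub>F idem_functor code (dual V)) x)
        (FOb (idem_functor code (dual W) \<circ>\<^sub>F idem_functor code F) x) (component (idem_nt code \<alpha>) x)"
      using idem_iso[OF code \<alpha> x] vol_functorD(5)[OF M Obj_idem(1)[OF code x]] Obj_idem(1)[OF code x]
      by (simp add: contra_simps(1-3)[OF dV] functor_simps[OF F])
  qed
  have "idem_nt code ((id_nt F \<circ>\<^sub>H eta V) \<bullet>\<^sub>V (op_nt \<alpha> \<circ>\<^sub>H id_nt (dual V))) =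
      idem_nt code ((eta W \<circ>\<^sub>H id_nt F) \<bullet>\<^sub>V (id_nt (op_functor (dual W)) \<circ>\<^sub>H \<alpha>))"
    using M by (simp add: vol_functor_def)
  \<comment> \<open>To distribute the completion over a vertical composite, the middle functor must
    be literally the same in both factors; the two whiskered transformations are retyped
    accordingly.\<close>
  moreover have "nt_between (UCat V) (UCat W) (op_functor (dual W \<circ>\<^sub>F F) \<circ>\<^sub>F dual V)
      (F \<circ>\<^sub>F (op_functor (dual V) \<circ>\<^sub>F dual V)) (op_nt \<alpha> \<circ>\<^sub>H id_nt (dual V))"
    using nt_hcomp[OF nt_op[OF \<alpha>] nt_id[OF dV]]
    by (simp add: op_comp_functor comp_functor_assoc[OF dV functor_op[OF dV, unfolded op_cat_simps] F])
  moreover have "nt_between (UCat V) (UCat W) (op_functor (dual W) \<circ>\<^sub>F (op_functor F \<circ>\<^sub>F dual V))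
      (op_functor (dual W) \<circ>\<^sub>F dual W \<circ>\<^sub>F F) (id_nt (op_functor (dual W)) \<circ>\<^sub>H \<alpha>)"
    using nt_hcomp[OF nt_id[OF dW'] \<alpha>] by (simp add: comp_functor_assoc[OF F dW dW'])
  ultimately have "(id_nt (idem_functor code F) \<circ>\<^sub>H idem_nt code (eta V)) \<bullet>\<^sub>V
        (op_nt (idem_nt code \<alpha>) \<circ>\<^sub>H id_nt (idem_functor code (dual V))) =
      (idem_nt code (eta W) \<circ>\<^sub>H id_nt (idem_functor code F)) \<bullet>\<^sub>V
        (id_nt (op_functor (idem_functor code (dual W))) \<circ>\<^sub>H idem_nt code \<alpha>)"
    using nt_hcomp[OF nt_id[OF F] eV] nt_hcomp[OF eW nt_id[OF F]]
    by (simp add: idem_nt_vcomp[OF code] idem_nt_hcomp[OF code nt_id[OF F] eV]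
        idem_nt_hcomp[OF code eW nt_id[OF F]] idem_nt_hcomp[OF code nt_op[OF \<alpha>] nt_id[OF dV]]
        idem_nt_hcomp[OF code nt_id[OF dW'] \<alpha>] idem_nt_id[OF code F] idem_nt_id[OF code dV]
        idem_nt_id[OF code dW'])
  then show ?thesis
    using iso IF V W by (simp add: vol_functor_def volutive_category_idem[OF code])
qed

text \<open>The completion distributes over the equation relating \<alpha> and \<beta>; here all
  middle functors already agree as written.\<close>

lemma vol_trans_idem:
  assumes \<phi>: "vol_trans V W M N \<phi>"
  shows "vol_trans (idem_volutive code V) (idem_volutive code W) (idem_vol_mor code M)
    (idem_vol_mor code N)
    (idem_nt code \<phi>)"
proof -
  obtain F \<alpha> G \<beta> where eqs [simp]: "M = (F, \<alpha>)" "N = (G, \<beta>)"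
    by (cases M; cases N)
  note M = vol_transD(1)[OF \<phi>, simplified] and N = vol_transD(2)[OF \<phi>, simplified]
    and \<phi>' = vol_transD(3)[OF \<phi>, simplified]
  note V = vol_functorD(1)[OF M] and W = vol_functorD(2)[OF M] and \<alpha> = vol_functorD(4)[OF M]
  note dV = volutive_category_simps(2)[OF V] and dW = volutive_category_simps(2)[OF W]
  note 1 = nt_hcomp[OF nt_op[OF \<phi>'] nt_id[OF dV]] and 2 = nt_hcomp[OF nt_id[OF dW] \<phi>']
  have "(id_nt (dual W) \<circ>\<^sub>H \<phi>) \<bullet>\<^sub>V \<alpha> \<bullet>\<^sub>V (op_nt \<phi> \<circ>\<^sub>H id_nt (dual V)) = \<beta>"
    using \<phi> by (simp add: vol_trans_def)
  then have "idem_nt code ((id_nt (dual W) \<circ>\<^sub>H \<phi>) \<bullet>\<^sub>V \<alpha> \<bullet>\<^sub>V (op_nt \<phi> \<circ>\<^sub>H id_nt (dual V))) = idem_nt code \<beta>"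
    by simp
  then have "(id_nt (idem_functor code (dual W)) \<circ>\<^sub>H idem_nt code \<phi>) \<bullet>\<^sub>V idem_nt code \<alpha> \<bullet>\<^sub>V
      (op_nt (idem_nt code \<phi>) \<circ>\<^sub>H id_nt (idem_functor code (dual V))) = idem_nt code \<beta>"
    unfolding idem_nt_vcomp[OF code nt_vcomp[OF 2 \<alpha>] 1] idem_nt_vcomp[OF code 2 \<alpha>]
      idem_nt_hcomp[OF code nt_op[OF \<phi>'] nt_id[OF dV]] idem_nt_hcomp[OF code nt_id[OF dW] \<phi>']
      idem_nt_op[OF code \<phi>'] idem_nt_id[OF code dV] idem_nt_id[OF code dW] .
  then show ?thesis
    using vol_functor_idem[OF M] vol_functor_idem[OF N] nt_idem[OF code \<phi>']
    by (simp add: vol_trans_def nt_between_def)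
qed

text \<open>The completion respects functor composition, whiskering and vertical composition
  strictly, so the two pastings are equal and not merely isomorphic.\<close>

lemma idem_vol_comp:
  assumes M: "vol_functor U V M" and N: "vol_functor V W N"
  shows "idem_vol_mor code (vol_comp N M) = vol_comp (idem_vol_mor code N) (idem_vol_mor code M)"
proof -
  obtain F \<alpha> G \<beta> where eqs [simp]: "M = (F, \<alpha>)" "N = (G, \<beta>)"
    by (cases M; cases N)
  note M = M[simplified] and N = N[simplified]
  note F = vol_functorD(3)[OF M] and G = vol_functorD(3)[OF N]
    and \<alpha> = vol_functorD(4)[OF M] and \<beta> = vol_functorD(4)[OF N]
  note dV = volutive_category_simps(2)[OF vol_functorD(1)[OF N]]
  have 1: "nt_between (UCat U) (op_cat (UCat W)) (op_functor G \<circ>\<^sub>F (op_functor F \<circ>\<^sub>F dual U))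
      (op_functor G \<circ>\<^sub>F dual V \<circ>\<^sub>F F) (id_nt (op_functor G) \<circ>\<^sub>H \<alpha>)"
    using nt_hcomp[OF nt_id[OF functor_op[OF G]] \<alpha>] by
      (simp add: comp_functor_assoc[OF F dV functor_op[OF G]])
  show ?thesis
    by (simp add: vol_comp_def idem_functor_comp[OF code F G]
      idem_nt_vcomp[OF code nt_hcomp[OF \<beta> nt_id[OF F]] 1]
        idem_nt_hcomp[OF code \<beta> nt_id[OF F]] idem_nt_hcomp[OF code nt_id[OF functor_op[OF G]] \<alpha>]
        idem_nt_id[OF code F] idem_nt_id[OF code functor_op[OF G]] idem_functor_op[OF code])
qed

section \<open>The 2-functor\<close>

lemma I_O1_simps [simp]:
  "FOb2 (I_O1 code) = idem_volutive code"
  "vol_functor V W M \<Longrightarrow> FOb (FHom (I_O1 code) V W) M = idem_vol_mor code M"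
  "vol_trans V W M N \<phi> \<Longrightarrow> FMor (FHom (I_O1 code) V W) M N \<phi> = idem_nt code \<phi>"
  by (simp_all add: I_O1_def split: prod.split)

text \<open>Functoriality on hom-categories is compatibility of the completion with identity
  transformations and vertical composites.\<close>

lemma functor_FHom_I_O1:
  "functor_between (vol_HomCat V W) (vol_HomCat (idem_volutive code V) (idem_volutive code W))
     (FHom (I_O1 code) V W)"
proof (rule functor_betweenI)
  show "FOb (FHom (I_O1 code) V W) M = undefined" if "M \<notin> Obj (vol_HomCat V W)" for M
    using that by (simp add: I_O1_def)
  show "FMor (FHom (I_O1 code) V W) M N \<phi> = undefined" if "\<phi> \<notin> Hom (vol_HomCat V W) M N" for M N \<phi>
    using that by (simp add: I_O1_def)
  show "FMor (FHom (I_O1 code) V W) M M (Idt (vol_HomCat V W) M) =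
      Idt (vol_HomCat (idem_volutive code V) (idem_volutive code W)) (FOb (FHom (I_O1 code) V W) M)"
    if "M \<in> Obj (vol_HomCat V W)" for M
    using that idem_nt_id[OF code vol_functorD(3)[of V W "fst M" "snd M"]]
    by (simp add: vol_trans_id vol_functor_idem)
  show "FMor (FHom (I_O1 code) V W) L N (Comp (vol_HomCat V W) L M N \<psi> \<phi>) =
      Comp (vol_HomCat (idem_volutive code V) (idem_volutive code W)) (FOb (FHom (I_O1 code) V W) L)
        (FOb (FHom (I_O1 code) V W) M) (FOb (FHom (I_O1 code) V W) N)
        (FMor (FHom (I_O1 code) V W) M N \<psi>) (FMor (FHom (I_O1 code) V W) L M \<phi>)"
    if "L \<in> Obj (vol_HomCat V W)" "M \<in> Obj (vol_HomCat V W)" "N \<in> Obj (vol_HomCat V W)"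
      "\<psi> \<in> Hom (vol_HomCat V W) M N" "\<phi> \<in> Hom (vol_HomCat V W) L M" for L M N \<psi> \<phi>
    using that by (simp add: vol_trans_vcomp vol_trans_idem
      idem_nt_vcomp[OF code vol_transD(3) vol_transD(3)])
  show "Dom (FHom (I_O1 code) V W) = vol_HomCat V W"
    "Cod (FHom (I_O1 code) V W) = vol_HomCat (idem_volutive code V) (idem_volutive code W)"
    by (simp_all add: I_O1_def)
qed (simp_all add: category_vol_HomCat vol_functor_idem vol_trans_idem)

text \<open>\<open>code\<close> may land in a new type of objects, so source and target are the same
  2-category at two different types; its axioms are therefore brought in twice.\<close>

lemma strict_2functor_I_O1: "strict_2functor Cat_O1_vol Cat_O1_vol (I_O1 code)"
proof -
  interpret S: strict_2category "Cat_O1_vol :: (('o, 'm) volutive, _, _) pre2category"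
    by (rule strict_2category_Cat_O1_vol)
  interpret T: strict_2category "Cat_O1_vol :: (('p, 'm) volutive, _, _) pre2category"
    by (rule strict_2category_Cat_O1_vol)
  show ?thesis
  proof
    fix U V W :: "('o, 'm) volutive"
    show "FOb2 (I_O1 code) V \<in> Obj2 Cat_O1_vol" if "V \<in> Obj2 Cat_O1_vol"
      using that by (simp add: volutive_category_idem[OF code])
    show "functor_between (HomCat Cat_O1_vol V W)
        (HomCat Cat_O1_vol (FOb2 (I_O1 code) V) (FOb2 (I_O1 code) W)) (FHom (I_O1 code) V W)"
      by (simp add: functor_FHom_I_O1)
    show "FOb (FHom (I_O1 code) V V) (Unit1 Cat_O1_vol V) = Unit1 Cat_O1_vol (FOb2 (I_O1 code) V)"
      if "V \<in> Obj2 Cat_O1_vol"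
      using that vol_functor_id[of V] idem_functor_id[OF code volutive_category_simps(1)[of V]]
        idem_nt_id[OF code volutive_category_simps(2)[of V]]
      by simp (simp add: vol_id_def)
    show "FOb (FHom (I_O1 code) U W) (FOb (HComp Cat_O1_vol U V W) (N, M)) =
       FOb (HComp Cat_O1_vol (FOb2 (I_O1 code) U) (FOb2 (I_O1 code) V) (FOb2 (I_O1 code) W))
         (FOb (FHom (I_O1 code) V W) N, FOb (FHom (I_O1 code) U V) M)"
      if "M \<in> Obj (HomCat Cat_O1_vol U V)" "N \<in> Obj (HomCat Cat_O1_vol V W)" for M N
      using that idem_vol_comp[of U V M W N] by (simp add: vol_functor_comp vol_functor_idem)
    show "FMor (FHom (I_O1 code) U W) (FOb (HComp Cat_O1_vol U V W) (N, M))
      (FOb (HComp Cat_O1_vol U V W) (N', M'))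
         (FMor (HComp Cat_O1_vol U V W) (N, M) (N', M') (\<psi>, \<phi>)) =
       FMor (HComp Cat_O1_vol (FOb2 (I_O1 code) U) (FOb2 (I_O1 code) V) (FOb2 (I_O1 code) W))
         (FOb (FHom (I_O1 code) V W) N, FOb (FHom (I_O1 code) U V) M)
         (FOb (FHom (I_O1 code) V W) N', FOb (FHom (I_O1 code) U V) M')
         (FMor (FHom (I_O1 code) V W) N N' \<psi>, FMor (FHom (I_O1 code) U V) M M' \<phi>)"
      if "\<phi> \<in> Hom (HomCat Cat_O1_vol U V) M M'" "\<psi> \<in> Hom (HomCat Cat_O1_vol V W) N N'" for M M' N N' \<phi> \<psi>
    proof -
      have *: "vol_functor U V M" "vol_functor U V M'" "vol_functor V W N" "vol_functor V W N'"
        using that by (auto dest: vol_transD)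
      with that show ?thesis
        using idem_nt_hcomp[OF code vol_transD(3) vol_transD(3), of V W N N' \<psi> U M M' \<phi>]
        by (simp add: vol_trans_hcomp vol_trans_idem)
    qed
  qed
qed

end

text \<open>With \<open>id\<close> the objects of the completion are literal pairs, whose type
  differs from that of the original objects, so source and target are different instances of the
  2-category. The coding within one type \<open>'u\<close> gives an endo-2-functor; such an
  injection exists for every infinite type.\<close>

theorem lemma3p18:
  fixes C :: "('o, 'm) precategory"
    and code :: "'u \<times> 'u \<Rightarrow> 'u"
  assumes "category C" and "inj code"
  shows "(\<forall>d \<eta>. volutive_structure C d \<eta> \<longrightarrow>
            volutive_structure (idem_compl id C) (idem_functor id d) (idem_nt id \<eta>)) \<and>
         strict_2functor (Cat_O1_vol :: (('o, 'm) volutive, _, _) pre2category)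
           (Cat_O1_vol :: (('o \<times> 'm, 'm) volutive, _, _) pre2category) (I_O1 id) \<and>
         strict_2functor (Cat_O1_vol :: (('u, 'u) volutive, _, _) pre2category)
           (Cat_O1_vol :: (('u, 'u) volutive, _, _) pre2category) (I_O1 code)"
  using volutive_structure_idem[OF inj_on_id] strict_2functor_I_O1[OF inj_on_id]
    strict_2functor_I_O1[OF assms(2)] by blast

end
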